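(* Let $\mathcal I$ be a monomial ideal in $\mathbb C\langle x_1,\dots,x_d\rangle$ with associated C*-correspondence ${}_AE_A$. The following are equivalent: (i) $P_\emptyset\in A$; (ii) $\ker\phi_E=\langle P_\emptyset\rangle$; (iii) $\ker\phi_E=\mathbb C\cdot P_\emptyset$; (iv) $\ker\phi_E\neq(0)$; (v) for every $i=1,\dots,d$ there is a $\mu_i\in\Lambda^*$ such that $\mu_ii\notin\Lambda^*$; (vi) for every $i=1,\dots,d$ there is a $\mu_i\in\mathbb F_+^d$ such that $x^{\mu_i}\notin\mathcal I$ and $x^{\mu_i}x_i\in\mathcal I$; (vii) $J_E:=(\ker\phi_E)^\perp\cap\phi_E^{-1}(\mathcal K(E))=\langle1-P_\emptyset\rangle=A(1-P_\emptyset)$; (viii) $1\notin J_E$. If these conditions hold then $\ker\phi_E=\langle T_{\mu_1}^*T_{\mu_1}\cdots T_{\mu_d}^*T_{\mu_d}\rangle$ for any tuple of words $(\mu_1,\dots,\mu_d)$ in $\Lambda^*$ such that $\mu_ii\notin\Lambda^*$ for all $i=1,\dots,d$.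
   Context: $\mathbb F_+^d$ is the free monoid of words in $\{1,\dots,d\}$, with empty word $\emptyset$; for $\mu=\mu_1\cdots\mu_n$ put $x^\mu=x_{\mu_1}\cdots x_{\mu_n}$ in the ring $\mathbb C\langle x_1,\dots,x_d\rangle$ of polynomials in noncommuting variables. A monomial ideal is a two-sided ideal generated by monomials; throughout, monomial ideals are generated by monomials of degree at least 2 (the zero ideal is allowed). For a monomial ideal $\mathcal I$ put $\Lambda^*=\{\mu\in\mathbb F_+^d: x^\mu\notin\mathcal I\}$. $\mathcal F_X$ is the Hilbert space with orthonormal basis $\{e_\mu:\mu\in\Lambda^*\}$, and $T_ie_\nu=e_{i\nu}$ if $i\nu\in\Lambda^*$, $T_ie_\nu=0$ otherwise. Put $T_\mu=T_{\mu_1}\cdots T_{\mu_n}$, $T_\emptyset=I$, and let $P_\emptyset\in B(\mathcal F_X)$ be the projection onto $\mathbb Ce_\emptyset$. $A=C^*(T_\mu^*T_\mu:\mu\in\Lambda^* )$ is unital (unit $1=I$) and commutative, and $E=\overline{\mathrm{span}}\{T_ia: a\in A,\ i=1,\dots,d\}$ is a C*-correspondence over $A$ with $a\cdot\xi\cdot b=a\xi b$, $\langle\xi,\eta\rangle=\xi^*\eta$ (operations in $B(\mathcal F_X)$), with left action $\phi_E:A\to\mathcal L(E)$. $\langle b\rangle$ denotes the closed ideal of $A$ generated by $b$ (so writing $\langle b\rangle$ includes the assertion $b\in A$), and for an ideal $K$ of $A$, $K^\perp=\{a\in A: aK=0\}$. *)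

theory Defs
  imports "HOL-Analysis.Analysis" "HOL-Library.Poly_Mapping" "HOL-Library.FuncSet"
begin

section \<open>Noncommutative polynomials and monomial ideals\<close>

text \<open>
  The letters \<open>1, \<dots>, d\<close> are the elements of a finite linearly ordered type \<open>'d\<close>, so that
  \<open>'d list\<close> is the free monoid of words. Under concatenation, written additively as
  \<open>Poly_Mapping\<close> demands, the convolution product makes \<open>'d list \<Rightarrow>\<^sub>0 complex\<close> the ring of
  polynomials in the noncommuting variables \<open>ncvar i\<close>.
\<close>

instantiation list :: (type) monoid_add
begin

definition zero_list :: "'a list" where "zero_list = []"

definition plus_list :: "'a list \<Rightarrow> 'a list \<Rightarrow> 'a list" where "plus_list = (@)"

instance
  by standard (simp_all add: zero_list_def plus_list_def)

end

type_synonym 'd ncpoly = "'d list \<Rightarrow>\<^sub>0 complex"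

definition ncvar :: "'d \<Rightarrow> 'd ncpoly"
  where "ncvar i = Poly_Mapping.single [i] 1"

definition ncmonom :: "'d list \<Rightarrow> 'd ncpoly"
  where "ncmonom \<mu> = prod_list (map ncvar \<mu>)"

definition two_sided_ideal :: "'r::ring_1 set \<Rightarrow> bool"
  where "two_sided_ideal J \<longleftrightarrow>
    0 \<in> J \<and> (\<forall>x\<in>J. \<forall>y\<in>J. x + y \<in> J) \<and> (\<forall>r. \<forall>x\<in>J. r * x \<in> J \<and> x * r \<in> J)"

definition monomial_ideal :: "'d ncpoly set \<Rightarrow> bool"
  where "monomial_ideal I \<longleftrightarrow>
    (\<exists>M. (\<forall>\<mu>\<in>M. 2 \<le> length \<mu>) \<and> I = two_sided_ideal hull (ncmonom ` M))"

definition allowed_words :: "'d ncpoly set \<Rightarrow> 'd list set"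
  where "allowed_words I = {\<mu>. ncmonom \<mu> \<notin> I}"


section \<open>Complex Hilbert spaces and their operators\<close>

class complex_vector = real_vector +
  fixes scaleC :: "complex \<Rightarrow> 'a \<Rightarrow> 'a"  (infixr \<open>*\<^sub>C\<close> 75)
  assumes scaleC_add_right: "c *\<^sub>C (x + y) = c *\<^sub>C x + c *\<^sub>C y"
    and scaleC_add_left: "(b + c) *\<^sub>C x = b *\<^sub>C x + c *\<^sub>C x"
    and scaleC_scaleC: "b *\<^sub>C c *\<^sub>C x = (b * c) *\<^sub>C x"
    and scaleC_one: "1 *\<^sub>C x = x"
    and scaleR_scaleC: "r *\<^sub>R x = complex_of_real r *\<^sub>C x"

global_interpretation complex_vector:
  vector_space "scaleC :: complex \<Rightarrow> 'a \<Rightarrow> 'a::complex_vector"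
  defines csubspace = complex_vector.subspace
    and cspan = complex_vector.span
  by unfold_locales
    (simp_all add: scaleC_add_right scaleC_add_left scaleC_scaleC scaleC_one)

text \<open>
  The inner product \<open>cinner\<close> is linear in its second argument. Its real part is the inner product
  of the class \<open>real_inner\<close>, which makes it positive definite and fixes the norm.
\<close>

class complex_hilbert = complex_vector + real_inner + complete_space +
  fixes cinner :: "'a \<Rightarrow> 'a \<Rightarrow> complex"
  assumes cinner_commute: "cinner x y = cnj (cinner y x)"
    and cinner_add_right: "cinner x (y + z) = cinner x y + cinner x z"
    and cinner_scaleC_right: "cinner x (c *\<^sub>C y) = c * cinner x y"
    and inner_eq_Re_cinner: "inner x y = Re (cinner x y)"

lemma norm_scaleC:
  fixes x :: "'h::complex_hilbert"
  shows "norm (c *\<^sub>C x) = cmod c * norm x"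
proof -
  have "cinner (c *\<^sub>C x) (c *\<^sub>C x) = c * (cnj c * cinner x x)"
    by (metis cinner_commute cinner_scaleC_right complex_cnj_mult)
  also have "\<dots> = complex_of_real ((cmod c)\<^sup>2) * cinner x x"
    by (subst complex_norm_square) (simp add: mult.assoc)
  finally have "inner (c *\<^sub>C x) (c *\<^sub>C x) = (cmod c)\<^sup>2 * inner x x"
    by (simp add: inner_eq_Re_cinner)
  then show ?thesis
    by (simp add: norm_eq_sqrt_inner real_sqrt_mult)
qed

lemma bounded_linear_scaleC: "bounded_linear (\<lambda>x::'h::complex_hilbert. c *\<^sub>C x)"
proof (rule bounded_linear_intro)
  show "c *\<^sub>C (x + y) = c *\<^sub>C x + c *\<^sub>C y" for x y :: 'h
    by (rule scaleC_add_right)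
  show "c *\<^sub>C (r *\<^sub>R x) = r *\<^sub>R (c *\<^sub>C x)" for r and x :: 'h
    by (simp add: scaleR_scaleC scaleC_scaleC mult.commute)
  show "norm (c *\<^sub>C x) \<le> norm x * cmod c" for x :: 'h
    by (simp add: norm_scaleC mult.commute)
qed

instantiation blinfun :: (real_normed_vector, complex_hilbert) complex_vector
begin

lift_definition scaleC_blinfun :: "complex \<Rightarrow> ('a \<Rightarrow>\<^sub>L 'b) \<Rightarrow> ('a \<Rightarrow>\<^sub>L 'b)"
  is "\<lambda>c T x. c *\<^sub>C T x"
  by (rule bounded_linear_compose[OF bounded_linear_scaleC])

instance
  by standard
    (transfer; simp add: fun_eq_iff scaleC_add_right scaleC_add_left scaleC_scaleC scaleC_one
      scaleR_scaleC)+

end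

type_synonym 'h op = "'h \<Rightarrow>\<^sub>L 'h"

text \<open>
  \<open>'h \<Rightarrow>\<^sub>L 'h\<close> consists of the real-linear bounded operators; \<open>bounded_ops\<close> is \<open>B(H)\<close>.
\<close>

definition bounded_ops :: "'h::complex_hilbert op set"
  where "bounded_ops = {T. \<forall>c x. blinfun_apply T (c *\<^sub>C x) = c *\<^sub>C blinfun_apply T x}"

text \<open>The Hilbert space adjoint, which exists and is unique for \<open>T \<in> bounded_ops\<close>.\<close>

definition adj :: "'h::complex_hilbert op \<Rightarrow> 'h op"
  where "adj T = (THE S. \<forall>x y. cinner (blinfun_apply S x) y = cinner x (blinfun_apply T y))"

definition orthonormal_basis_on :: "'i set \<Rightarrow> ('i \<Rightarrow> 'h::complex_hilbert) \<Rightarrow> bool"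
  where "orthonormal_basis_on L e \<longleftrightarrow>
    (\<forall>\<mu>\<in>L. \<forall>\<nu>\<in>L. cinner (e \<mu>) (e \<nu>) = (if \<mu> = \<nu> then 1 else 0)) \<and>
    closure (cspan (e ` L)) = UNIV"

definition rank_one_proj :: "'h::complex_hilbert \<Rightarrow> 'h op"
  where "rank_one_proj u = Blinfun (\<lambda>x. cinner u x *\<^sub>C u)" \<comment> \<open>for a unit vector \<open>u\<close>\<close>

definition cstar_subalgebra :: "'h::complex_hilbert op set \<Rightarrow> bool"
  where "cstar_subalgebra A \<longleftrightarrow>
    A \<subseteq> bounded_ops \<and> csubspace A \<and> closed A \<and>
    (\<forall>S\<in>A. \<forall>T\<in>A. S o\<^sub>L T \<in> A) \<and> (\<forall>T\<in>A. adj T \<in> A)"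

definition closed_ideal :: "'h::complex_hilbert op set \<Rightarrow> 'h op set \<Rightarrow> bool"
  where "closed_ideal A K \<longleftrightarrow>
    K \<subseteq> A \<and> csubspace K \<and> closed K \<and> (\<forall>a\<in>A. \<forall>k\<in>K. a o\<^sub>L k \<in> K \<and> k o\<^sub>L a \<in> K)"

text \<open>Only meaningful for \<open>b \<in> A\<close>; otherwise the intersection is over the empty family.\<close>

definition gen_ideal :: "'h::complex_hilbert op set \<Rightarrow> 'h op \<Rightarrow> 'h op set"
  where "gen_ideal A b = closed_ideal A hull {b}"

definition annihilator :: "'h::complex_hilbert op set \<Rightarrow> 'h op set \<Rightarrow> 'h op set"
  where "annihilator A K = {a \<in> A. \<forall>k\<in>K. a o\<^sub>L k = 0}"


section \<open>Correspondences of operators\<close>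

text \<open>
  A correspondence \<open>E\<close> over \<open>A\<close> is a closed space of operators with bimodule structure given by
  composition and with inner product \<open>\<langle>\<xi>, \<eta>\<rangle> = \<xi>\<^sup>*\<eta> \<in> A\<close>. Maps on \<open>E\<close> are functions on operators
  restricted to \<open>E\<close> (undefined outside), so that equality of maps is equality on \<open>E\<close>.
\<close>

definition module_inner :: "'h::complex_hilbert op \<Rightarrow> 'h op \<Rightarrow> 'h op"
  where "module_inner \<xi> \<eta> = adj \<xi> o\<^sub>L \<eta>"

definition module_norm :: "'h::complex_hilbert op \<Rightarrow> real"
  where "module_norm \<xi> = sqrt (norm (module_inner \<xi> \<xi>))"

definition adjointable_ops :: "'h::complex_hilbert op set \<Rightarrow> ('h op \<Rightarrow> 'h op) set"
  where "adjointable_ops E =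
    {t \<in> E \<rightarrow>\<^sub>E E. \<exists>s \<in> E \<rightarrow>\<^sub>E E. \<forall>\<xi>\<in>E. \<forall>\<eta>\<in>E. module_inner (t \<xi>) \<eta> = module_inner \<xi> (s \<eta>)}"

text \<open>The complex span of the maps \<open>\<theta>\<^bsub>\<xi>,\<eta>\<^esub> \<zeta> = \<xi> \<cdot> \<langle>\<eta>, \<zeta>\<rangle>\<close>.\<close>

definition finite_rank_ops :: "'h::complex_hilbert op set \<Rightarrow> ('h op \<Rightarrow> 'h op) set"
  where "finite_rank_ops E =
    {t. \<exists>(n::nat) c \<xi> \<eta>. (\<forall>k<n. \<xi> k \<in> E \<and> \<eta> k \<in> E) \<and>
      t = (\<lambda>\<zeta>\<in>E. \<Sum>k<n. c k *\<^sub>C (\<xi> k o\<^sub>L module_inner (\<eta> k) \<zeta>))}"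

text \<open>
  The closure of the finite rank maps in \<open>\<L>(E)\<close>: the innermost condition says that the operator
  norm of \<open>t - s\<close> is at most \<open>\<epsilon>\<close>.
\<close>

definition compact_ops :: "'h::complex_hilbert op set \<Rightarrow> ('h op \<Rightarrow> 'h op) set"
  where "compact_ops E =
    {t \<in> adjointable_ops E. \<forall>\<epsilon>>0. \<exists>s \<in> finite_rank_ops E.
      \<forall>\<zeta>\<in>E. module_norm (t \<zeta> - s \<zeta>) \<le> \<epsilon> * module_norm \<zeta>}"

definition left_action :: "'h::complex_hilbert op set \<Rightarrow> 'h op \<Rightarrow> 'h op \<Rightarrow> 'h op"
  where "left_action E a = (\<lambda>\<xi>\<in>E. a o\<^sub>L \<xi>)"

definition ker_left_action :: "'h::complex_hilbert op set \<Rightarrow> 'h op set \<Rightarrow> 'h op set"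
  where "ker_left_action A E = {a \<in> A. left_action E a = (\<lambda>\<xi>\<in>E. 0)}"

definition katsura_ideal :: "'h::complex_hilbert op set \<Rightarrow> 'h op set \<Rightarrow> 'h op set"
  where "katsura_ideal A E =
    annihilator A (ker_left_action A E) \<inter> {a \<in> A. left_action E a \<in> compact_ops E}"


section \<open>The correspondence of a monomial ideal\<close>

text \<open>
  Below \<open>L\<close> is the set \<open>\<Lambda>\<^sup>*\<close> of allowed words and \<open>e\<close> is an orthonormal basis of \<open>\<F>\<^sub>X\<close>
  indexed by it; the values of \<open>e\<close> outside \<open>L\<close> are irrelevant. The description defining
  \<open>creation\<close> is proper: an operator is determined by its values on an orthonormal basis, and
  \<open>e \<nu> \<mapsto> e (i # \<nu>)\<close> is injective, so it extends to a partial isometry.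
\<close>

definition creation :: "'d list set \<Rightarrow> ('d list \<Rightarrow> 'h::complex_hilbert) \<Rightarrow> 'd \<Rightarrow> 'h op"
  where "creation L e i =
    (THE T. T \<in> bounded_ops \<and>
      (\<forall>\<nu>\<in>L. blinfun_apply T (e \<nu>) = (if i # \<nu> \<in> L then e (i # \<nu>) else 0)))"

definition creation_word :: "'d list set \<Rightarrow> ('d list \<Rightarrow> 'h::complex_hilbert) \<Rightarrow> 'd list \<Rightarrow> 'h op"
  where "creation_word L e \<mu> = foldr (\<lambda>i S. creation L e i o\<^sub>L S) \<mu> id_blinfun"

definition source_proj :: "'d list set \<Rightarrow> ('d list \<Rightarrow> 'h::complex_hilbert) \<Rightarrow> 'd list \<Rightarrow> 'h op"
  where "source_proj L e \<mu> = adj (creation_word L e \<mu>) o\<^sub>L creation_word L e \<mu>"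

definition coeff_algebra :: "'d list set \<Rightarrow> ('d list \<Rightarrow> 'h::complex_hilbert) \<Rightarrow> 'h op set"
  where "coeff_algebra L e = cstar_subalgebra hull (source_proj L e ` L)"

definition correspondence :: "'d list set \<Rightarrow> ('d list \<Rightarrow> 'h::complex_hilbert) \<Rightarrow> 'h op set"
  where "correspondence L e =
    closure (cspan {creation L e i o\<^sub>L a |i a. a \<in> coeff_algebra L e})"

text \<open>\<open>T\<^bsub>\<mu> 1\<^esub>\<^sup>*T\<^bsub>\<mu> 1\<^esub> \<cdots> T\<^bsub>\<mu> d\<^esub>\<^sup>*T\<^bsub>\<mu> d\<^esub>\<close>, with the letters taken in increasing order.\<close>

definition source_proj_prod ::
  "'d::{finite,linorder} list set \<Rightarrow> ('d list \<Rightarrow> 'h::complex_hilbert) \<Rightarrow> ('d \<Rightarrow> 'd list) \<Rightarrow> 'h op"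
  where "source_proj_prod L e \<mu> =
    foldr (\<lambda>i S. source_proj L e (\<mu> i) o\<^sub>L S) (sorted_list_of_set UNIV) id_blinfun"

end

theory Submission
  imports Defs
begin

text \<open>
  Everything in sight is diagonal. The projection \<open>T\<^sub>\<mu>\<^sup>* T\<^sub>\<mu>\<close> fixes \<open>e\<^sub>\<nu>\<close> if \<open>\<mu>\<nu>\<close> is allowed and kills it
  otherwise, so \<open>A\<close> consists of diagonal operators and an element \<open>a\<close> of \<open>A\<close> is determined by its
  entries \<open>a(\<nu>)\<close>.

  The kernel of the left action comes first. Since \<open>A\<close> is unital, \<open>a\<close> acts by zero on \<open>E\<close> exactly
  if \<open>a T\<^sub>i = 0\<close> for all \<open>i\<close>, that is, if \<open>a(\<nu>) = 0\<close> for all \<open>\<nu> \<noteq> \<emptyset>\<close>. Hence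
  \<open>ker \<phi> = A \<inter> \<complex>P\<close>, which is \<open>\<complex>P\<close> or \<open>0\<close> according to whether \<open>P \<in> A\<close>
  (\<open>ker_left_action_eq_span\<close>, \<open>ker_left_action_eq_0\<close>).

  The combinatorial condition decides which case occurs (\<open>vacuum_proj_in_coeff_algebra_iff\<close>). If
  \<open>\<mu>\<^sub>i\<close> is allowed and \<open>\<mu>\<^sub>ii\<close> is not, for every \<open>i\<close>, then the product of the projections
  \<open>T\<^sub>\<mu>\<^sup>* T\<^sub>\<mu>\<close> over \<open>\<mu> = \<mu>\<^sub>1, \<dots>, \<mu>\<^sub>d\<close> is \<open>P\<close> itself: a nonempty word \<open>\<nu> = j\<nu>'\<close> is killed by the
  factor with index \<open>j\<close>. If on the contrary some letter \<open>i\<close> can be appended to every allowed word,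
  then \<open>a(\<emptyset>) = a(i)\<close> holds for the generators, hence for all \<open>a \<in> A\<close>, and \<open>P\<close> violates it.

  For Katsura's ideal, \<open>a T\<^sub>i = T\<^sub>i (T\<^sub>i\<^sup>* a T\<^sub>i)\<close> with \<open>T\<^sub>i\<^sup>* a T\<^sub>i \<in> A\<close>
  (\<open>compression_in_coeff_algebra\<close>) shows that \<open>E\<close> is a left \<open>A\<close>-module, and
  \<open>1 - P = \<Sum>\<^sub>i T\<^sub>i T\<^sub>i\<^sup>*\<close> shows that every \<open>a \<in> A\<close> acts by a map of finite rank
  (\<open>left_action_finite_rank\<close>). So the ideal is just the annihilator of the kernel: all of \<open>A\<close> if
  \<open>P \<notin> A\<close>, and \<open>{a. a(\<emptyset>) = 0} = A(1 - P)\<close> if \<open>P \<in> A\<close>.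

  The analytic input is that adjoints and creation operators exist. Both are built from the
  coefficients of their values, by way of the Riesz-Fischer theorem (\<open>operator_from_coeffs\<close>).
\<close>


section \<open>Complex Hilbert spaces\<close>

lemma cinner_scaleC_left:
  fixes x y :: "'h::complex_hilbert"
  shows "cinner (c *\<^sub>C x) y = cnj c * cinner x y"
  by (metis cinner_commute cinner_scaleC_right complex_cnj_mult)

lemma cinner_add_left:
  fixes x y z :: "'h::complex_hilbert"
  shows "cinner (x + y) z = cinner x z + cinner y z"
  by (metis cinner_commute cinner_add_right complex_cnj_add)

lemma cinner_self:
  fixes x :: "'h::complex_hilbert"
  shows "cinner x x = complex_of_real ((norm x)\<^sup>2)"
proof (rule complex_eqI)
  show "Re (cinner x x) = Re (complex_of_real ((norm x)\<^sup>2))"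
    by (simp add: inner_eq_Re_cinner[symmetric] power2_norm_eq_inner)
  show "Im (cinner x x) = Im (complex_of_real ((norm x)\<^sup>2))"
    using arg_cong[OF cinner_commute[of x x], of Im] by simp
qed

lemma cmod_cinner_le:
  fixes x y :: "'h::complex_hilbert"
  shows "cmod (cinner x y) \<le> norm x * norm y"
proof (cases "cinner x y = 0")
  case False
  \<comment> \<open>Rotating \<open>y\<close> by a phase makes the inner product real, where the real inequality applies.\<close>
  define c where "c = cnj (cinner x y) / cmod (cinner x y)"
  have "cmod c = 1"
    using False by (simp add: c_def norm_divide)
  have "cinner x (c *\<^sub>C y) = cmod (cinner x y)"
    using False by (simp add: c_def cinner_scaleC_right complex_norm_square[symmetric]
        mult.commute power2_eq_square)
  then have "cmod (cinner x y) = inner x (c *\<^sub>C y)"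
    by (simp add: inner_eq_Re_cinner)
  also have "\<dots> \<le> norm x * norm (c *\<^sub>C y)"
    by (rule norm_cauchy_schwarz)
  finally show ?thesis
    by (simp add: norm_scaleC \<open>cmod c = 1\<close>)
qed simp

lemma bounded_bilinear_cinner:
  "bounded_bilinear (cinner :: 'h::complex_hilbert \<Rightarrow> 'h \<Rightarrow> complex)"
proof
  show "\<exists>K. \<forall>a b :: 'h. cmod (cinner a b) \<le> norm a * norm b * K"
    by (intro exI[of _ 1]) (simp add: cmod_cinner_le)
qed (simp_all add: cinner_add_left cinner_add_right scaleR_scaleC cinner_scaleC_left
    cinner_scaleC_right scaleR_conv_of_real)

interpretation cinner: bounded_bilinear "cinner :: 'h::complex_hilbert \<Rightarrow> 'h \<Rightarrow> complex"
  by (rule bounded_bilinear_cinner)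

lemmas cinner_zero_left [simp] = cinner.zero_left
  and cinner_zero_right [simp] = cinner.zero_right

lemma cinner_eqI:
  fixes x y :: "'h::complex_hilbert"
  assumes "\<And>z. cinner z x = cinner z y"
  shows "x = y"
  using assms[of "x - y"] cinner_self[of "x - y"] by (simp add: cinner.diff_right)

lemma closed_csubspace_cinner_eq_0:
  fixes y :: "'h::complex_hilbert"
  shows "csubspace {x. cinner x y = 0}" "closed {x. cinner x y = 0}"
  by (auto simp: complex_vector.subspace_def cinner_add_left cinner_scaleC_left
      intro!: closed_Collect_eq continuous_intros cinner.continuous_on)

lemma closure_cspan_subset:
  fixes X :: "'a::{complex_vector, topological_space} set"
  assumes "X \<subseteq> S" "csubspace S" "closed S"
  shows "closure (cspan X) \<subseteq> S"
  by (intro closure_minimal complex_vector.span_minimal assms)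


section \<open>Bounded operators and adjoints\<close>

lemma bounded_opsD: "T \<in> bounded_ops \<Longrightarrow> blinfun_apply T (c *\<^sub>C x) = c *\<^sub>C blinfun_apply T x"
  by (simp add: bounded_ops_def)

lemma bounded_ops_compose: "S \<in> bounded_ops \<Longrightarrow> T \<in> bounded_ops \<Longrightarrow> S o\<^sub>L T \<in> bounded_ops"
  by (simp add: bounded_ops_def)

lemma id_in_bounded_ops: "id_blinfun \<in> bounded_ops"
  by (simp add: bounded_ops_def)

lemma csubspace_bounded_ops: "csubspace bounded_ops"
  by (auto simp: complex_vector.subspace_def bounded_ops_def blinfun.add_left
      scaleC_blinfun.rep_eq scaleC_add_right scaleC_scaleC mult.commute)

lemma closed_bounded_ops: "closed (bounded_ops :: 'h::complex_hilbert op set)"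
  unfolding bounded_ops_def
  by (intro closed_Collect_all closed_Collect_eq continuous_intros
      bounded_linear.continuous_on[OF bounded_linear_scaleC])

lemma blinfun_compose_assoc: "(R o\<^sub>L S) o\<^sub>L T = R o\<^sub>L (S o\<^sub>L T)"
  by (rule blinfun_eqI) simp

lemma blinfun_compose_id: "T o\<^sub>L id_blinfun = T" "id_blinfun o\<^sub>L T = T"
  by (auto intro!: blinfun_eqI)

lemma blinfun_compose_add_right: "R o\<^sub>L (S + T) = (R o\<^sub>L S) + (R o\<^sub>L T)"
  by (rule blinfun_eqI) (simp add: blinfun.add_left blinfun.add_right)

lemma compose_scaleC_blinfun:
  fixes S T :: "'h::complex_hilbert op"
  shows "S \<in> bounded_ops \<Longrightarrow> S o\<^sub>L (c *\<^sub>C T) = c *\<^sub>C (S o\<^sub>L T)"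
  by (auto intro!: blinfun_eqI simp: scaleC_blinfun.rep_eq bounded_opsD)

lemma adj_eqI:
  fixes S T :: "'h::complex_hilbert op"
  assumes "\<And>x y. cinner (S x) y = cinner x (T y)"
  shows "adj T = S"
  unfolding adj_def
proof (rule the_equality)
  fix R :: "'h op"
  assume R: "\<forall>x y. cinner (R x) y = cinner x (T y)"
  show "R = S"
  proof (intro blinfun_eqI cinner_eqI)
    show "cinner z (R x) = cinner z (S x)" for z x
      by (metis R assms cinner_commute)
  qed
qed (use assms in simp)

locale hilbert_basis =
  fixes L :: "'i set" and e :: "'i \<Rightarrow> 'h::complex_hilbert"
  assumes basis: "orthonormal_basis_on L e"
begin

lemma cinner_basis: "\<mu> \<in> L \<Longrightarrow> \<nu> \<in> L \<Longrightarrow> cinner (e \<mu>) (e \<nu>) = (if \<mu> = \<nu> then 1 else 0)"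
  using basis by (simp add: orthonormal_basis_on_def)

lemma basis_subset_UNIV:
  assumes "e ` L \<subseteq> S" "csubspace S" "closed S"
  shows "S = UNIV"
  using closure_cspan_subset[OF assms] basis by (auto simp: orthonormal_basis_on_def)

lemma coeffs_eqI:
  assumes "\<And>\<nu>. \<nu> \<in> L \<Longrightarrow> cinner (e \<nu>) x = cinner (e \<nu>) y"
  shows "x = y"
proof (rule cinner_eqI)
  have "{z. cinner z (x - y) = 0} = UNIV"
    using assms by (intro basis_subset_UNIV closed_csubspace_cinner_eq_0)
      (auto simp: cinner.diff_right)
  then show "cinner z x = cinner z y" for z
    by (auto simp: cinner.diff_right set_eq_iff)
qed

lemma bounded_ops_eqI:
  fixes S T :: "'h op"
  assumes "S \<in> bounded_ops" "T \<in> bounded_ops" "\<And>\<nu>. \<nu> \<in> L \<Longrightarrow> S (e \<nu>) = T (e \<nu>)"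
  shows "S = T"
proof (rule blinfun_eqI)
  have "{x. S x = T x} = UNIV"
  proof (rule basis_subset_UNIV)
    show "csubspace {x. S x = T x}"
      using assms by (auto simp: complex_vector.subspace_def bounded_opsD blinfun.add_right)
    show "closed {x. S x = T x}"
      by (intro closed_Collect_eq continuous_intros)
  qed (use assms in auto)
  then show "S x = T x" for x
    by auto
qed

lemma cinner_finite_combination:
  assumes "finite F" "F \<subseteq> L" "\<mu> \<in> L"
  shows "cinner (e \<mu>) (\<Sum>\<nu>\<in>F. c \<nu> *\<^sub>C e \<nu>) = (if \<mu> \<in> F then c \<mu> else 0)"
proof -
  have "cinner (e \<mu>) (\<Sum>\<nu>\<in>F. c \<nu> *\<^sub>C e \<nu>) = (\<Sum>\<nu>\<in>F. if \<mu> = \<nu> then c \<nu> else 0)"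
    unfolding cinner.sum_right
    using assms by (intro sum.cong) (auto simp: cinner_scaleC_right cinner_basis subset_iff)
  then show ?thesis
    using assms by simp
qed

lemma norm_finite_combination:
  assumes "finite F" "F \<subseteq> L"
  shows "(norm (\<Sum>\<nu>\<in>F. c \<nu> *\<^sub>C e \<nu>))\<^sup>2 = (\<Sum>\<nu>\<in>F. (cmod (c \<nu>))\<^sup>2)"
proof -
  let ?y = "\<Sum>\<nu>\<in>F. c \<nu> *\<^sub>C e \<nu>"
  have "cinner ?y ?y = (\<Sum>\<nu>\<in>F. cnj (c \<nu>) * cinner (e \<nu>) ?y)"
    by (subst cinner.sum_left) (simp add: cinner_scaleC_left)
  also have "\<dots> = (\<Sum>\<nu>\<in>F. complex_of_real ((cmod (c \<nu>))\<^sup>2))"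
    using assms by (intro sum.cong refl)
      (auto simp: cinner_finite_combination subset_iff complex_norm_square mult.commute
        simp del: of_real_power)
  finally have "complex_of_real ((norm ?y)\<^sup>2) = complex_of_real (\<Sum>\<nu>\<in>F. (cmod (c \<nu>))\<^sup>2)"
    by (simp only: cinner_self of_real_sum)
  then show ?thesis
    by (simp only: of_real_eq_iff)
qed

text \<open>
  With \<open>y = \<Sum>\<^sub>\<nu> \<langle>T e\<^sub>\<nu>, x\<rangle> e\<^sub>\<nu>\<close> the sum \<open>s\<close> over \<open>F\<close> equals both \<open>\<langle>T y, x\<rangle>\<close> and \<open>\<parallel>y\<parallel>\<^sup>2\<close>, so
  \<open>s \<le> \<parallel>T\<parallel> \<surd>s \<parallel>x\<parallel>\<close>. For \<open>T = 1\<close> this is Bessel's inequality; in general it makes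
  \<open>\<langle>T e\<^sub>\<nu>, x\<rangle>\<close> admissible as the coefficients of \<open>T\<^sup>* x\<close>.
\<close>

lemma bessel_inequality:
  fixes T :: "'h op"
  assumes "T \<in> bounded_ops" "finite F" "F \<subseteq> L"
  shows "(\<Sum>\<nu>\<in>F. (cmod (cinner (T (e \<nu>)) x))\<^sup>2) \<le> (norm T * norm x)\<^sup>2"
proof -
  define c where "c \<nu> = cinner (T (e \<nu>)) x" for \<nu>
  define y where "y = (\<Sum>\<nu>\<in>F. c \<nu> *\<^sub>C e \<nu>)"
  have y: "(norm y)\<^sup>2 = (\<Sum>\<nu>\<in>F. (cmod (c \<nu>))\<^sup>2)"
    unfolding y_def by (rule norm_finite_combination[OF assms(2,3)])
  have "cinner (T y) x = (\<Sum>\<nu>\<in>F. cnj (c \<nu>) * c \<nu>)"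
    by (simp add: y_def blinfun.sum_right bounded_opsD[OF assms(1)] cinner.sum_left
        cinner_scaleC_left c_def)
  also have "\<dots> = complex_of_real ((norm y)\<^sup>2)"
    by (simp only: y of_real_sum complex_norm_square mult.commute)
  finally have "(norm y)\<^sup>2 = cmod (cinner (T y) x)"
    by (metis norm_of_real abs_of_nonneg zero_le_power2)
  also have "\<dots> \<le> norm (T y) * norm x"
    by (rule cmod_cinner_le)
  also have "\<dots> \<le> (norm T * norm y) * norm x"
    by (intro mult_right_mono norm_blinfun norm_ge_zero)
  finally have "norm y * norm y \<le> norm y * (norm T * norm x)"
    by (simp add: power2_eq_square mult_ac)
  then have "norm y \<le> norm T * norm x"
    by (cases "norm y = 0") auto
  then show ?thesis
    using y power_mono[OF _ norm_ge_zero, of y "norm T * norm x" 2] by (simp add: c_def)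
qed

text \<open>
  Past a finite set of indices the squares of the coefficients have arbitrarily small sums, so the
  partial sums of \<open>\<Sum>\<^sub>\<nu> c\<^sub>\<nu> e\<^sub>\<nu>\<close> form a Cauchy net.
\<close>

lemma Riesz_Fischer:
  fixes c :: "'i \<Rightarrow> complex"
  assumes B: "0 \<le> B"
    and bound: "\<And>F. finite F \<Longrightarrow> F \<subseteq> L \<Longrightarrow> (\<Sum>\<nu>\<in>F. (cmod (c \<nu>))\<^sup>2) \<le> B\<^sup>2"
  shows "\<exists>x. (\<forall>\<nu>\<in>L. cinner (e \<nu>) x = c \<nu>) \<and> norm x \<le> B"
proof -
  define f where "f \<nu> = c \<nu> *\<^sub>C e \<nu>" for \<nu>
  define s where "s F = (\<Sum>\<nu>\<in>F. (cmod (c \<nu>))\<^sup>2)" for F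
  have norm_f: "(norm (sum f F))\<^sup>2 = s F" if "finite F" "F \<subseteq> L" for F
    unfolding f_def s_def by (rule norm_finite_combination[OF that])
  let ?FL = "{F. finite F \<and> F \<subseteq> L}"
  have bdd: "bdd_above (s ` ?FL)"
    using bound by (auto simp: s_def intro!: bdd_aboveI2[where M = "B\<^sup>2"])
  have "\<exists>P. eventually P (finite_subsets_at_top L) \<and>
      (\<forall>F F'. P F \<and> P F' \<longrightarrow> dist (sum f F) (sum f F') < \<epsilon>)" if "\<epsilon> > 0" for \<epsilon>
  proof -
    have "(SUP F\<in>?FL. s F) - (\<epsilon>/2)\<^sup>2 < (SUP F\<in>?FL. s F)"
      using \<open>\<epsilon> > 0\<close> by simp
    moreover have "?FL \<noteq> {}"
      by blast
    ultimately obtain G where G: "finite G" "G \<subseteq> L" "(SUP F\<in>?FL. s F) - (\<epsilon>/2)\<^sup>2 < s G"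
      using less_cSUP_iff[OF _ bdd, of "(SUP F\<in>?FL. s F) - (\<epsilon>/2)\<^sup>2"] by auto
    have tail: "norm (sum f F - sum f G) < \<epsilon>/2" if F: "finite F" "F \<subseteq> L" "G \<subseteq> F" for F
    proof -
      have "s F \<le> (SUP F\<in>?FL. s F)"
        using F by (intro cSUP_upper bdd) auto
      moreover have "s (F - G) = s F - s G"
        unfolding s_def using F by (intro sum_diff) auto
      ultimately have "s (F - G) < (\<epsilon>/2)\<^sup>2"
        using G(3) by linarith
      moreover have "(norm (sum f F - sum f G))\<^sup>2 = s (F - G)"
        using F by (subst norm_f[symmetric]) (auto simp: sum_diff)
      ultimately show ?thesis
        using \<open>\<epsilon> > 0\<close> power2_less_imp_less[of "norm (sum f F - sum f G)" "\<epsilon>/2"] by simp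
    qed
    have "dist (sum f F) (sum f F') < \<epsilon>"
      if "finite F \<and> F \<subseteq> L \<and> G \<subseteq> F" "finite F' \<and> F' \<subseteq> L \<and> G \<subseteq> F'" for F F'
      using dist_triangle2[of "sum f F" "sum f F'" "sum f G"] tail[of F] tail[of F'] that
      by (simp add: dist_norm)
    moreover have "eventually (\<lambda>F. finite F \<and> F \<subseteq> L \<and> G \<subseteq> F) (finite_subsets_at_top L)"
      using G unfolding eventually_finite_subsets_at_top by (intro exI[of _ G]) auto
    ultimately show ?thesis
      by (intro exI[of _ "\<lambda>F. finite F \<and> F \<subseteq> L \<and> G \<subseteq> F"]) simp
  qed
  then have cauchy: "cauchy_filter (filtermap (sum f) (finite_subsets_at_top L))"
    by (simp add: cauchy_filter_metric_filtermap)
  have "complete (UNIV :: 'h set)"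
    unfolding complete_def using Cauchy_convergent by (auto simp: convergent_def)
  from cauchy_filter_complete_converges[OF cauchy this]
  obtain x where x: "(sum f \<longlongrightarrow> x) (finite_subsets_at_top L)"
    by (auto simp: filterlim_def filtermap_bot_iff)
  have "norm x \<le> B"
  proof (rule tendsto_upperbound[OF tendsto_norm[OF x]])
    have "norm (sum f F) \<le> B" if "finite F" "F \<subseteq> L" for F
      using norm_f[OF that] bound[OF that] power2_le_imp_le[OF _ B] by (simp add: s_def)
    then show "\<forall>\<^sub>F F in finite_subsets_at_top L. norm (sum f F) \<le> B"
      by (intro eventually_finite_subsets_at_top_weakI) auto
  qed simp
  moreover have "cinner (e \<mu>) x = c \<mu>" if "\<mu> \<in> L" for \<mu>
  proof (rule tendsto_unique[OF _ cinner.tendsto[OF tendsto_const x]])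
    have "\<forall>\<^sub>F F in finite_subsets_at_top L. cinner (e \<mu>) (sum f F) = c \<mu>"
      unfolding eventually_finite_subsets_at_top f_def
      using that by (intro exI[of _ "{\<mu>}"]) (auto simp: cinner_finite_combination)
    then show "((\<lambda>F. cinner (e \<mu>) (sum f F)) \<longlongrightarrow> c \<mu>) (finite_subsets_at_top L)"
      by (rule tendsto_eventually)
  qed simp
  ultimately show ?thesis
    by blast
qed

text \<open>
  An operator is prescribed by the coefficients of its values. Both adjoints and the creation
  operators arise in this way.
\<close>

lemma operator_from_coeffs:
  fixes \<phi> :: "'i \<Rightarrow> 'h \<Rightarrow> complex"
  assumes add: "\<And>\<nu> x y. \<nu> \<in> L \<Longrightarrow> \<phi> \<nu> (x + y) = \<phi> \<nu> x + \<phi> \<nu> y"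
    and scale: "\<And>\<nu> c x. \<nu> \<in> L \<Longrightarrow> \<phi> \<nu> (c *\<^sub>C x) = c * \<phi> \<nu> x"
    and B: "0 \<le> B"
    and bound: "\<And>F x. finite F \<Longrightarrow> F \<subseteq> L \<Longrightarrow>
      (\<Sum>\<nu>\<in>F. (cmod (\<phi> \<nu> x))\<^sup>2) \<le> (B * norm x)\<^sup>2"
  obtains S :: "'h op" where "S \<in> bounded_ops"
    and "\<And>x \<nu>. \<nu> \<in> L \<Longrightarrow> cinner (e \<nu>) (S x) = \<phi> \<nu> x"
proof -
  have "\<forall>x. \<exists>y. (\<forall>\<nu>\<in>L. cinner (e \<nu>) y = \<phi> \<nu> x) \<and> norm y \<le> B * norm x"
    using B bound by (intro allI Riesz_Fischer) auto
  then obtain g where g: "\<And>x \<nu>. \<nu> \<in> L \<Longrightarrow> cinner (e \<nu>) (g x) = \<phi> \<nu> x"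
    and g_le: "\<And>x. norm (g x) \<le> B * norm x"
    by metis
  have g_scale: "g (c *\<^sub>C x) = c *\<^sub>C g x" for c x
    by (rule coeffs_eqI) (simp add: g scale cinner_scaleC_right)
  have bl: "bounded_linear g"
  proof (rule bounded_linear_intro)
    show "g (x + y) = g x + g y" for x y
      by (rule coeffs_eqI) (simp add: g add cinner_add_right)
    show "g (r *\<^sub>R x) = r *\<^sub>R g x" for r x
      by (simp add: scaleR_scaleC g_scale)
    show "norm (g x) \<le> norm x * B" for x
      by (metis g_le mult.commute)
  qed
  show ?thesis
    by (rule that[of "Blinfun g"])
      (simp_all add: bounded_ops_def bounded_linear_Blinfun_apply[OF bl] g_scale g)
qed

lemma
  fixes T :: "'h op"
  assumes T: "T \<in> bounded_ops"
  shows cinner_adj_left: "cinner (adj T x) y = cinner x (T y)"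
    and adj_in_bounded_ops: "adj T \<in> bounded_ops"
proof -
  obtain S where S: "S \<in> bounded_ops"
    and coeff: "\<And>x \<nu>. \<nu> \<in> L \<Longrightarrow> cinner (e \<nu>) (S x) = cinner (T (e \<nu>)) x"
    by (rule operator_from_coeffs[where \<phi> = "\<lambda>\<nu> x. cinner (T (e \<nu>)) x" and B = "norm T"])
      (simp_all add: cinner_add_right cinner_scaleC_right bessel_inequality[OF T])
  have swap: "cinner z (S x) = cinner (T z) x" for x z
  proof -
    have "{z. cinner z (S x) = cinner (T z) x} = UNIV"
    proof (rule basis_subset_UNIV)
      show "csubspace {z. cinner z (S x) = cinner (T z) x}"
        using T by (auto simp: complex_vector.subspace_def bounded_opsD blinfun.add_right
            cinner_add_left cinner_scaleC_left)
      show "closed {z. cinner z (S x) = cinner (T z) x}"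
        by (intro closed_Collect_eq cinner.continuous_on continuous_intros)
    qed (use coeff in auto)
    then show ?thesis
      by auto
  qed
  have eq: "cinner (S x) y = cinner x (T y)" for x y
    by (subst (1 2) cinner_commute) (simp add: swap)
  then have "adj T = S"
    by (rule adj_eqI)
  then show "cinner (adj T x) y = cinner x (T y)" "adj T \<in> bounded_ops"
    using S eq by simp_all
qed

lemma cinner_adj_right:
  fixes T :: "'h op"
  shows "T \<in> bounded_ops \<Longrightarrow> cinner x (adj T y) = cinner (T x) y"
  by (subst (1 2) cinner_commute) (simp add: cinner_adj_left)

lemma adj_adj:
  fixes T :: "'h op"
  shows "T \<in> bounded_ops \<Longrightarrow> adj (adj T) = T"
  by (rule adj_eqI) (simp add: cinner_adj_right)

lemma adj_compose:
  fixes S T :: "'h op"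
  shows "S \<in> bounded_ops \<Longrightarrow> T \<in> bounded_ops \<Longrightarrow> adj (S o\<^sub>L T) = adj T o\<^sub>L adj S"
  by (rule adj_eqI) (simp add: cinner_adj_left)

lemma adj_id: "adj id_blinfun = (id_blinfun :: 'h op)"
  by (rule adj_eqI) simp


section \<open>Diagonal operators\<close>

text \<open>
  Vanishing of the off-diagonal entries is a closed linear condition that is symmetric under
  adjoints; \<open>diagonal_apply\<close> recovers the description by eigenvectors.
\<close>

definition diagonal_ops :: "'h op set"
  where "diagonal_ops =
    {a \<in> bounded_ops. \<forall>\<mu>\<in>L. \<forall>\<nu>\<in>L. \<mu> \<noteq> \<nu> \<longrightarrow> cinner (e \<mu>) (a (e \<nu>)) = 0}"

definition entry :: "'h op \<Rightarrow> 'i \<Rightarrow> complex"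
  where "entry a \<nu> = cinner (e \<nu>) (a (e \<nu>))"

lemma diagonal_ops_bounded: "a \<in> diagonal_ops \<Longrightarrow> a \<in> bounded_ops"
  by (simp add: diagonal_ops_def)

lemma diagonal_apply: "a \<in> diagonal_ops \<Longrightarrow> \<nu> \<in> L \<Longrightarrow> a (e \<nu>) = entry a \<nu> *\<^sub>C e \<nu>"
  by (rule coeffs_eqI) (auto simp: diagonal_ops_def entry_def cinner_scaleC_right cinner_basis)

lemma diagonalI:
  assumes "a \<in> bounded_ops" "\<And>\<nu>. \<nu> \<in> L \<Longrightarrow> a (e \<nu>) = c \<nu> *\<^sub>C e \<nu>"
  shows "a \<in> diagonal_ops \<and> (\<forall>\<nu>\<in>L. entry a \<nu> = c \<nu>)"
  using assms by (auto simp: diagonal_ops_def entry_def cinner_scaleC_right cinner_basis)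

lemma diagonal_eqI:
  assumes "a \<in> diagonal_ops" "b \<in> diagonal_ops" "\<And>\<nu>. \<nu> \<in> L \<Longrightarrow> entry a \<nu> = entry b \<nu>"
  shows "a = b"
  using assms by (intro bounded_ops_eqI) (auto simp: diagonal_apply diagonal_ops_bounded)

lemma entry_simps:
  "entry 0 \<nu> = 0"
  "entry (a + b) \<nu> = entry a \<nu> + entry b \<nu>"
  "entry (a - b) \<nu> = entry a \<nu> - entry b \<nu>"
  "entry (c *\<^sub>C a) \<nu> = c * entry a \<nu>"
  by (simp_all add: entry_def blinfun.add_left blinfun.diff_left scaleC_blinfun.rep_eq
      cinner_add_right cinner.diff_right cinner_scaleC_right)

lemma entry_id: "\<nu> \<in> L \<Longrightarrow> entry id_blinfun \<nu> = 1"
  by (simp add: entry_def cinner_basis)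

lemma entry_adj: "a \<in> bounded_ops \<Longrightarrow> entry (adj a) \<nu> = cnj (entry a \<nu>)"
  unfolding entry_def by (subst (2) cinner_commute) (simp add: cinner_adj_right)

lemma
  assumes "a \<in> diagonal_ops" "b \<in> diagonal_ops"
  shows diagonal_compose: "a o\<^sub>L b \<in> diagonal_ops"
    and entry_compose: "\<nu> \<in> L \<Longrightarrow> entry (a o\<^sub>L b) \<nu> = entry a \<nu> * entry b \<nu>"
proof -
  have "(a o\<^sub>L b) (e \<nu>) = (entry a \<nu> * entry b \<nu>) *\<^sub>C e \<nu>" if "\<nu> \<in> L" for \<nu>
    using assms that
    by (simp add: diagonal_apply bounded_opsD[OF diagonal_ops_bounded] scaleC_scaleC mult.commute)
  then show "a o\<^sub>L b \<in> diagonal_ops" "\<nu> \<in> L \<Longrightarrow> entry (a o\<^sub>L b) \<nu> = entry a \<nu> * entry b \<nu>"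
    using diagonalI[of "a o\<^sub>L b" "\<lambda>\<nu>. entry a \<nu> * entry b \<nu>"] assms
    by (auto simp: bounded_ops_compose diagonal_ops_bounded)
qed

lemma closed_entry_eq: "closed {a. entry a \<mu> = entry a \<nu>}"
  unfolding entry_def
  by (intro closed_Collect_eq cinner.continuous_on continuous_intros)

lemma cstar_subalgebra_diagonal_ops: "cstar_subalgebra diagonal_ops"
  unfolding cstar_subalgebra_def
proof (intro conjI ballI)
  show "diagonal_ops \<subseteq> bounded_ops"
    by (auto simp: diagonal_ops_bounded)
  show "csubspace diagonal_ops"
    using csubspace_bounded_ops
    by (auto simp: complex_vector.subspace_def diagonal_ops_def blinfun.add_left
        scaleC_blinfun.rep_eq cinner_add_right cinner_scaleC_right)
  have eq: "diagonal_ops = bounded_ops \<inter>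
      (\<Inter>\<mu>\<in>L. \<Inter>\<nu>\<in>L - {\<mu>}. {a :: 'h op. cinner (e \<mu>) (a (e \<nu>)) = 0})"
    by (auto simp: diagonal_ops_def)
  show "closed diagonal_ops"
    unfolding eq
    by (intro closed_Int closed_bounded_ops closed_INT ballI closed_Collect_eq
        cinner.continuous_on continuous_intros)
  show "a o\<^sub>L b \<in> diagonal_ops" if "a \<in> diagonal_ops" "b \<in> diagonal_ops" for a b
    by (rule diagonal_compose[OF that])
  show "adj a \<in> diagonal_ops" if "a \<in> diagonal_ops" for a
  proof -
    have "cinner (e \<mu>) (adj a (e \<nu>)) = cnj (cinner (e \<nu>) (a (e \<mu>)))" for \<mu> \<nu>
      using that by (subst (2) cinner_commute) (simp add: cinner_adj_right diagonal_ops_bounded)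
    then show ?thesis
      using that by (simp add: diagonal_ops_def adj_in_bounded_ops)
  qed
qed

end

section \<open>The Fock space of a factorial language\<close>

text \<open>
  The allowed words of a monomial ideal form such a language: it contains the empty word and is
  closed under taking factors.
\<close>

locale fock_space = hilbert_basis L e
  for L :: "'d::{finite,linorder} list set" and e :: "'d list \<Rightarrow> 'h::complex_hilbert" +
  assumes Nil_in_L: "[] \<in> L"
    and prefix_closed: "\<mu> @ \<nu> \<in> L \<Longrightarrow> \<mu> \<in> L"
    and suffix_closed: "\<mu> @ \<nu> \<in> L \<Longrightarrow> \<nu> \<in> L"
begin

abbreviation "T \<equiv> creation L e"
abbreviation "A \<equiv> coeff_algebra L e"
abbreviation "E \<equiv> correspondence L e"
abbreviation "P \<equiv> rank_one_proj (e [])"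

lemma Cons_in_L: "i # \<nu> \<in> L \<Longrightarrow> \<nu> \<in> L"
  using suffix_closed[of "[i]" \<nu>] by simp

text \<open>
  The value of \<open>T\<^sub>i\<close> at \<open>x\<close> has the coefficient \<open>\<langle>e\<^sub>\<nu>, x\<rangle>\<close> at \<open>i\<nu>\<close> and \<open>0\<close> at words that do not begin
  with \<open>i\<close>; Bessel's inequality bounds these coefficients.
\<close>

lemma creation_exists:
  "\<exists>S. S \<in> bounded_ops \<and> (\<forall>\<nu>\<in>L. S (e \<nu>) = (if i # \<nu> \<in> L then e (i # \<nu>) else 0))"
proof -
  define \<phi> where
    "\<phi> \<rho> x = (case \<rho> of [] \<Rightarrow> 0 | j # \<nu> \<Rightarrow> if j = i then cinner (e \<nu>) x else 0)" for \<rho> x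
  have bound: "(\<Sum>\<rho>\<in>F. (cmod (\<phi> \<rho> x))\<^sup>2) \<le> (1 * norm x)\<^sup>2" if F: "finite F" "F \<subseteq> L" for F x
  proof -
    let ?G = "{\<nu>. i # \<nu> \<in> F}"
    have "finite ?G"
      using finite_vimageI[OF F(1), of "Cons i"] by (simp add: vimage_def)
    have "(\<Sum>\<rho>\<in>F. (cmod (\<phi> \<rho> x))\<^sup>2) = (\<Sum>\<rho>\<in>Cons i ` ?G. (cmod (\<phi> \<rho> x))\<^sup>2)"
      by (rule sum.mono_neutral_right) (use F in \<open>auto simp: \<phi>_def split: list.splits\<close>)
    also have "\<dots> = (\<Sum>\<nu>\<in>?G. (cmod (cinner (e \<nu>) x))\<^sup>2)"
      by (subst sum.reindex) (auto simp: \<phi>_def)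
    also have "\<dots> \<le> (norm (id_blinfun :: 'h op) * norm x)\<^sup>2"
      using bessel_inequality[OF id_in_bounded_ops \<open>finite ?G\<close>] F by (auto dest: Cons_in_L)
    also have "\<dots> \<le> (1 * norm x)\<^sup>2"
      by (intro power_mono mult_right_mono norm_blinfun_id_le) auto
    finally show ?thesis .
  qed
  obtain S :: "'h op" where S: "S \<in> bounded_ops"
    and coeff: "\<And>x \<rho>. \<rho> \<in> L \<Longrightarrow> cinner (e \<rho>) (S x) = \<phi> \<rho> x"
    by (rule operator_from_coeffs[of \<phi> 1])
      (use bound in \<open>auto simp: \<phi>_def cinner_add_right cinner_scaleC_right split: list.split\<close>)
  have "S (e \<nu>) = (if i # \<nu> \<in> L then e (i # \<nu>) else 0)" if "\<nu> \<in> L" for \<nu>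
    using that by (intro coeffs_eqI)
      (auto simp: coeff \<phi>_def cinner_basis dest: Cons_in_L split: list.splits)
  with S show ?thesis
    by blast
qed

lemma creation_in_bounded_ops: "T i \<in> bounded_ops"
  and creation_apply: "\<nu> \<in> L \<Longrightarrow> T i (e \<nu>) = (if i # \<nu> \<in> L then e (i # \<nu>) else 0)"
proof -
  have "\<exists>!S. S \<in> bounded_ops \<and> (\<forall>\<nu>\<in>L. S (e \<nu>) = (if i # \<nu> \<in> L then e (i # \<nu>) else 0))"
    using creation_exists[of i]
  proof (rule ex_ex1I)
    show "S = S'"
      if "S \<in> bounded_ops \<and> (\<forall>\<nu>\<in>L. S (e \<nu>) = (if i # \<nu> \<in> L then e (i # \<nu>) else 0))"
        "S' \<in> bounded_ops \<and> (\<forall>\<nu>\<in>L. S' (e \<nu>) = (if i # \<nu> \<in> L then e (i # \<nu>) else 0))"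
      for S S'
      using that by (intro bounded_ops_eqI) simp_all
  qed
  from theI'[OF this] show "T i \<in> bounded_ops"
    "\<nu> \<in> L \<Longrightarrow> T i (e \<nu>) = (if i # \<nu> \<in> L then e (i # \<nu>) else 0)"
    unfolding creation_def by auto
qed

lemma adj_creation_apply:
  assumes "\<rho> \<in> L"
  shows "adj (T i) (e \<rho>) = (case \<rho> of [] \<Rightarrow> 0 | j # \<nu> \<Rightarrow> if j = i then e \<nu> else 0)"
  using assms
  by (intro coeffs_eqI)
    (auto simp: cinner_adj_right creation_in_bounded_ops creation_apply cinner_basis
      dest: Cons_in_L split: list.split)

lemma creation_word_in_bounded_ops: "creation_word L e \<mu> \<in> bounded_ops"
  by (induction \<mu>)
    (simp_all add: creation_word_def id_in_bounded_ops bounded_ops_compose creation_in_bounded_ops)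

lemma creation_word_apply:
  "\<nu> \<in> L \<Longrightarrow> creation_word L e \<mu> (e \<nu>) = (if \<mu> @ \<nu> \<in> L then e (\<mu> @ \<nu>) else 0)"
proof (induction \<mu>)
  case (Cons i \<mu>)
  then show ?case
    using Cons_in_L[of i "\<mu> @ \<nu>"] by (simp add: creation_word_def creation_apply)
qed (simp add: creation_word_def)

lemma source_proj_diagonal: "source_proj L e \<mu> \<in> diagonal_ops"
  and entry_source_proj: "\<nu> \<in> L \<Longrightarrow> entry (source_proj L e \<mu>) \<nu> = (if \<mu> @ \<nu> \<in> L then 1 else 0)"
proof -
  have "source_proj L e \<mu> \<in> bounded_ops"
    by (simp add: source_proj_def bounded_ops_compose adj_in_bounded_ops
        creation_word_in_bounded_ops)
  moreover have "source_proj L e \<mu> (e \<nu>) = (if \<mu> @ \<nu> \<in> L then 1 else 0) *\<^sub>C e \<nu>" if "\<nu> \<in> L" for \<nu>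
    using that
    by (intro coeffs_eqI) (auto simp: source_proj_def cinner_adj_right
      creation_word_in_bounded_ops creation_word_apply cinner_basis cinner_scaleC_right)
  ultimately have "source_proj L e \<mu> \<in> diagonal_ops \<and>
      (\<forall>\<nu>\<in>L. entry (source_proj L e \<mu>) \<nu> = (if \<mu> @ \<nu> \<in> L then 1 else 0))"
    by (rule diagonalI)
  then show "source_proj L e \<mu> \<in> diagonal_ops"
    "\<nu> \<in> L \<Longrightarrow> entry (source_proj L e \<mu>) \<nu> = (if \<mu> @ \<nu> \<in> L then 1 else 0)"
    by simp_all
qed

lemma vacuum_proj_apply: "P x = cinner (e []) x *\<^sub>C e []"
proof -
  have "bounded_linear (\<lambda>x. cinner (e []) x *\<^sub>C e [])"
  proof (rule bounded_linear_intro)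
    show "norm (cinner (e []) x *\<^sub>C e []) \<le> norm x * (norm (e []) * norm (e []))" for x
      using mult_right_mono[OF cmod_cinner_le[of "e []" x] norm_ge_zero[of "e []"]]
      by (simp add: norm_scaleC mult_ac)
  qed (simp_all add: cinner_add_right scaleC_add_left scaleR_scaleC cinner_scaleC_right
      scaleC_scaleC)
  then show ?thesis
    by (simp add: rank_one_proj_def bounded_linear_Blinfun_apply)
qed

lemma vacuum_proj_diagonal: "P \<in> diagonal_ops"
  and entry_vacuum_proj: "\<nu> \<in> L \<Longrightarrow> entry P \<nu> = (if \<nu> = [] then 1 else 0)"
proof -
  have "P \<in> bounded_ops"
    by (simp add: bounded_ops_def vacuum_proj_apply cinner_scaleC_right scaleC_scaleC)
  moreover have "P (e \<nu>) = (if \<nu> = [] then 1 else 0) *\<^sub>C e \<nu>" if "\<nu> \<in> L" for \<nu>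
    using that by (simp add: vacuum_proj_apply cinner_basis Nil_in_L)
  ultimately have "P \<in> diagonal_ops \<and> (\<forall>\<nu>\<in>L. entry P \<nu> = (if \<nu> = [] then 1 else 0))"
    by (rule diagonalI)
  then show "P \<in> diagonal_ops" "\<nu> \<in> L \<Longrightarrow> entry P \<nu> = (if \<nu> = [] then 1 else 0)"
    by simp_all
qed

lemma vacuum_proj_nonzero: "P \<noteq> 0"
  using entry_vacuum_proj[OF Nil_in_L] by (auto simp: entry_simps)

lemma sum_range_projections: "(\<Sum>i\<in>UNIV. T i o\<^sub>L adj (T i)) = id_blinfun - P"
proof (rule bounded_ops_eqI)
  show "(\<Sum>i\<in>UNIV. T i o\<^sub>L adj (T i)) \<in> bounded_ops"
    by (intro complex_vector.subspace_sum csubspace_bounded_ops bounded_ops_compose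
        creation_in_bounded_ops adj_in_bounded_ops)
  show "id_blinfun - P \<in> bounded_ops"
    by (intro complex_vector.subspace_diff csubspace_bounded_ops id_in_bounded_ops
        diagonal_ops_bounded vacuum_proj_diagonal)
  fix \<rho>
  assume \<rho>: "\<rho> \<in> L"
  show "(\<Sum>i\<in>UNIV. T i o\<^sub>L adj (T i)) (e \<rho>) = (id_blinfun - P) (e \<rho>)"
  proof (cases \<rho>)
    case Nil
    then show ?thesis
      using \<rho> by (simp add: blinfun.sum_left blinfun.diff_left adj_creation_apply
          vacuum_proj_apply cinner_basis scaleC_one)
  next
    case (Cons j \<nu>)
    have "(T i o\<^sub>L adj (T i)) (e \<rho>) = (if j = i then e \<rho> else 0)" for i
      using \<rho> Cons Cons_in_L[of j \<nu>] by (cases "j = i")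
        (auto simp: adj_creation_apply creation_apply)
    then show ?thesis
      using \<rho> Cons Nil_in_L
      by (simp add: blinfun.sum_left blinfun.diff_left vacuum_proj_apply cinner_basis
        del: blinfun_apply_blinfun_compose)
  qed
qed


section \<open>The coefficient algebra\<close>

lemma coeff_algebra_subset:
  assumes "cstar_subalgebra S" "\<And>\<mu>. \<mu> \<in> L \<Longrightarrow> source_proj L e \<mu> \<in> S"
  shows "A \<subseteq> S"
  unfolding coeff_algebra_def using assms by (intro hull_minimal) auto

lemma coeff_algebra_diagonal: "A \<subseteq> diagonal_ops"
  by (intro coeff_algebra_subset cstar_subalgebra_diagonal_ops source_proj_diagonal)

lemma cstar_subalgebra_coeff_algebra: "cstar_subalgebra A"
proof -
  have "closed A" "csubspace A"
    unfolding coeff_algebra_def hull_def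
    by (auto simp: cstar_subalgebra_def intro!: closed_Inter complex_vector.subspace_Inter)
  moreover have "a o\<^sub>L b \<in> A" if "a \<in> A" "b \<in> A" for a b
    using that unfolding coeff_algebra_def hull_def by (auto simp: cstar_subalgebra_def)
  moreover have "adj a \<in> A" if "a \<in> A" for a
    using that unfolding coeff_algebra_def hull_def by (auto simp: cstar_subalgebra_def)
  ultimately show ?thesis
    using coeff_algebra_diagonal diagonal_ops_bounded by (auto simp: cstar_subalgebra_def)
qed

lemma
  assumes "a \<in> A"
  shows coeff_in_bounded_ops: "a \<in> bounded_ops"
    and coeff_in_diagonal_ops: "a \<in> diagonal_ops"
    and adj_in_coeff_algebra: "adj a \<in> A"
    and compose_in_coeff_algebra: "b \<in> A \<Longrightarrow> a o\<^sub>L b \<in> A"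
  using assms coeff_algebra_diagonal cstar_subalgebra_coeff_algebra
  by (auto simp: cstar_subalgebra_def)

lemma csubspace_coeff_algebra: "csubspace A"
  and closed_coeff_algebra: "closed A"
  using cstar_subalgebra_coeff_algebra by (auto simp: cstar_subalgebra_def)

lemma source_proj_in_coeff_algebra: "\<mu> \<in> L \<Longrightarrow> source_proj L e \<mu> \<in> A"
  unfolding coeff_algebra_def by (intro hull_inc) auto

lemma id_in_coeff_algebra: "id_blinfun \<in> A"
  using source_proj_in_coeff_algebra[OF Nil_in_L]
  by (simp add: source_proj_def creation_word_def adj_id blinfun_compose_id)

lemma compression_diagonal: "a \<in> diagonal_ops \<Longrightarrow> adj (T i) o\<^sub>L a o\<^sub>L T i \<in> diagonal_ops"
  and entry_compression: "a \<in> diagonal_ops \<Longrightarrow> \<nu> \<in> L \<Longrightarrow>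
    entry (adj (T i) o\<^sub>L a o\<^sub>L T i) \<nu> = (if i # \<nu> \<in> L then entry a (i # \<nu>) else 0)"
proof -
  assume a: "a \<in> diagonal_ops"
  have "adj (T i) o\<^sub>L a o\<^sub>L T i \<in> bounded_ops"
    by (intro bounded_ops_compose adj_in_bounded_ops creation_in_bounded_ops
        diagonal_ops_bounded a)
  moreover have "(adj (T i) o\<^sub>L a o\<^sub>L T i) (e \<nu>) =
      (if i # \<nu> \<in> L then entry a (i # \<nu>) else 0) *\<^sub>C e \<nu>" if "\<nu> \<in> L" for \<nu>
    using that a by (simp add: creation_apply diagonal_apply adj_creation_apply
        bounded_opsD[OF adj_in_bounded_ops[OF creation_in_bounded_ops]])
  ultimately have "adj (T i) o\<^sub>L a o\<^sub>L T i \<in> diagonal_ops \<and> (\<forall>\<nu>\<in>L.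
      entry (adj (T i) o\<^sub>L a o\<^sub>L T i) \<nu> = (if i # \<nu> \<in> L then entry a (i # \<nu>) else 0))"
    by (rule diagonalI)
  then show "adj (T i) o\<^sub>L a o\<^sub>L T i \<in> diagonal_ops"
    "\<nu> \<in> L \<Longrightarrow> entry (adj (T i) o\<^sub>L a o\<^sub>L T i) \<nu> = (if i # \<nu> \<in> L then entry a (i # \<nu>) else 0)"
    by simp_all
qed

text \<open>
  On generators this reads \<open>T\<^sub>i\<^sup>* T\<^sub>\<mu>\<^sup>* T\<^sub>\<mu> T\<^sub>i = T\<^bsub>\<mu>i\<^esub>\<^sup>* T\<^bsub>\<mu>i\<^esub>\<close>, which is \<open>0\<close> unless \<open>\<mu>i\<close> is allowed.
  It passes to the whole algebra because the diagonal operators commute with the projection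
  \<open>T\<^sub>i T\<^sub>i\<^sup>*\<close>, so that compression by \<open>T\<^sub>i\<close> is multiplicative on them.
\<close>

lemma compression_in_coeff_algebra:
  assumes "a \<in> A"
  shows "adj (T i) o\<^sub>L a o\<^sub>L T i \<in> A"
proof -
  define S where "S = {a \<in> diagonal_ops. adj (T i) o\<^sub>L a o\<^sub>L T i \<in> A}"
  have comp: "adj (T i) o\<^sub>L a o\<^sub>L T i \<in> diagonal_ops" if "a \<in> diagonal_ops" for a
    by (rule compression_diagonal[OF that])
  note D = cstar_subalgebra_diagonal_ops[unfolded cstar_subalgebra_def]
  have "cstar_subalgebra S"
    unfolding cstar_subalgebra_def
  proof (intro conjI ballI)
    show "S \<subseteq> bounded_ops"
      by (auto simp: S_def diagonal_ops_bounded)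
    have "adj (T i) o\<^sub>L (a + b) o\<^sub>L T i = (adj (T i) o\<^sub>L a o\<^sub>L T i) + (adj (T i) o\<^sub>L b o\<^sub>L T i)"
      for a b
      by (rule blinfun_eqI) (simp add: blinfun.add_left blinfun.add_right)
    moreover have "adj (T i) o\<^sub>L (c *\<^sub>C a) o\<^sub>L T i = c *\<^sub>C (adj (T i) o\<^sub>L a o\<^sub>L T i)" for c a
      by (rule blinfun_eqI)
        (simp add: scaleC_blinfun.rep_eq bounded_opsD adj_in_bounded_ops creation_in_bounded_ops)
    moreover have "adj (T i) o\<^sub>L 0 o\<^sub>L T i = 0"
      by (rule blinfun_eqI) simp
    ultimately show "csubspace S"
      using D csubspace_coeff_algebra by (auto simp: S_def complex_vector.subspace_def)
    have "S = diagonal_ops \<inter> (\<lambda>a. adj (T i) o\<^sub>L a o\<^sub>L T i) -` A"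
      by (auto simp: S_def)
    moreover have "continuous_on UNIV (\<lambda>a. adj (T i) o\<^sub>L a o\<^sub>L T i)"
      by (intro bounded_bilinear.continuous_on[OF bounded_bilinear_blinfun_compose]
          continuous_intros)
    ultimately show "closed S"
      using D closed_coeff_algebra by (auto intro!: closed_Int closed_vimage)
    show "a o\<^sub>L b \<in> S" if "a \<in> S" "b \<in> S" for a b
    proof -
      have ab: "a \<in> diagonal_ops" "b \<in> diagonal_ops"
        using that by (auto simp: S_def)
      have "adj (T i) o\<^sub>L (a o\<^sub>L b) o\<^sub>L T i =
          (adj (T i) o\<^sub>L a o\<^sub>L T i) o\<^sub>L (adj (T i) o\<^sub>L b o\<^sub>L T i)"
        using ab by (intro diagonal_eqI)
          (auto simp: comp diagonal_compose entry_compose entry_compression)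
      then show ?thesis
        using that by (auto simp: S_def diagonal_compose compose_in_coeff_algebra)
    qed
    show "adj a \<in> S" if "a \<in> S" for a
    proof -
      have a: "a \<in> diagonal_ops" "adj (T i) o\<^sub>L a o\<^sub>L T i \<in> A"
        using that by (auto simp: S_def)
      have "adj (adj (T i) o\<^sub>L a o\<^sub>L T i) = adj (T i) o\<^sub>L adj a o\<^sub>L T i"
        using a(1) by (simp add: adj_compose adj_adj bounded_ops_compose adj_in_bounded_ops
            creation_in_bounded_ops diagonal_ops_bounded blinfun_compose_assoc)
      then show ?thesis
        using a D adj_in_coeff_algebra[OF a(2)] by (simp add: S_def)
    qed
  qed
  moreover have "source_proj L e \<mu> \<in> S" if "\<mu> \<in> L" for \<mu>
  proof -
    have "adj (T i) o\<^sub>L source_proj L e \<mu> o\<^sub>L T i =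
        (if \<mu> @ [i] \<in> L then source_proj L e (\<mu> @ [i]) else 0)"
    proof (rule diagonal_eqI)
      show "adj (T i) o\<^sub>L source_proj L e \<mu> o\<^sub>L T i \<in> diagonal_ops"
        by (intro comp source_proj_diagonal)
      show "(if \<mu> @ [i] \<in> L then source_proj L e (\<mu> @ [i]) else 0) \<in> diagonal_ops"
        using D by (auto simp: source_proj_diagonal complex_vector.subspace_0)
      show "entry (adj (T i) o\<^sub>L source_proj L e \<mu> o\<^sub>L T i) \<nu> =
          entry (if \<mu> @ [i] \<in> L then source_proj L e (\<mu> @ [i]) else 0) \<nu>" if "\<nu> \<in> L" for \<nu>
        using that prefix_closed[of "\<mu> @ [i]" \<nu>] suffix_closed[of \<mu> "i # \<nu>"]
        by (auto simp: source_proj_diagonal entry_compression entry_source_proj entry_simps)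
    qed
    then show ?thesis
      using complex_vector.subspace_0[OF csubspace_coeff_algebra]
      by (simp add: S_def source_proj_diagonal source_proj_in_coeff_algebra)
  qed
  ultimately show ?thesis
    using coeff_algebra_subset[of S] assms by (auto simp: S_def)
qed


section \<open>The vacuum projection in the coefficient algebra\<close>

lemma source_proj_prod_in_coeff_algebra:
  assumes "\<And>i. \<mu> i \<in> L"
  shows "source_proj_prod L e \<mu> \<in> A"
proof -
  have "foldr (\<lambda>i S. source_proj L e (\<mu> i) o\<^sub>L S) is id_blinfun \<in> A" for "is"
    by (induction "is")
      (simp_all add: id_in_coeff_algebra compose_in_coeff_algebra source_proj_in_coeff_algebra assms)
  then show ?thesis
    by (simp add: source_proj_prod_def)
qed

text \<open>
  The diagonal entry at \<open>\<nu>\<close> of the product is \<open>1\<close> if all \<open>\<mu>\<^sub>i\<nu>\<close> are allowed, and \<open>0\<close> otherwise.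
  For \<open>\<nu> = \<emptyset>\<close> they are; for \<open>\<nu> = j\<nu>'\<close> the word \<open>\<mu>\<^sub>j\<nu>\<close> has the forbidden prefix \<open>\<mu>\<^sub>jj\<close>.
\<close>

lemma source_proj_prod_eq_vacuum_proj:
  assumes "\<And>i. \<mu> i \<in> L" "\<And>i. \<mu> i @ [i] \<notin> L"
  shows "source_proj_prod L e \<mu> = P"
proof (rule diagonal_eqI)
  have fold: "foldr (\<lambda>i S. source_proj L e (\<mu> i) o\<^sub>L S) is id_blinfun \<in> diagonal_ops \<and>
      (\<forall>\<nu>\<in>L. entry (foldr (\<lambda>i S. source_proj L e (\<mu> i) o\<^sub>L S) is id_blinfun) \<nu> =
        (if \<forall>i\<in>set is. \<mu> i @ \<nu> \<in> L then 1 else 0))" for "is"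
    by (induction "is")
      (auto simp: id_in_coeff_algebra coeff_in_diagonal_ops entry_id diagonal_compose entry_compose
        source_proj_diagonal entry_source_proj)
  then show "source_proj_prod L e \<mu> \<in> diagonal_ops"
    by (simp add: source_proj_prod_def)
  show "P \<in> diagonal_ops"
    by (rule vacuum_proj_diagonal)
  fix \<nu>
  assume \<nu>: "\<nu> \<in> L"
  have "\<mu> j @ j # \<nu>' \<notin> L" for j \<nu>'
    using assms(2)[of j] prefix_closed[of "\<mu> j @ [j]" \<nu>'] by auto
  then have "(\<forall>i. \<mu> i @ \<nu> \<in> L) \<longleftrightarrow> \<nu> = []"
    using assms(1) by (cases \<nu>) auto
  then show "entry (source_proj_prod L e \<mu>) \<nu> = entry P \<nu>"
    using \<nu> fold[of "sorted_list_of_set UNIV"]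
    by (simp add: source_proj_prod_def entry_vacuum_proj)
qed

text \<open>
  If every \<open>\<mu>i\<close> with \<open>\<mu>\<close> allowed is again allowed, no generator distinguishes the vacuum \<open>\<emptyset>\<close> from
  the word \<open>i\<close>: the diagonal entries at these two words agree on the generators and hence on all
  of \<open>A\<close>, whereas those of \<open>P\<close> differ.
\<close>

lemma vacuum_proj_in_coeff_algebra_iff:
  "P \<in> A \<longleftrightarrow> (\<forall>i. \<exists>\<mu>\<in>L. \<mu> @ [i] \<notin> L)"
proof
  assume P: "P \<in> A"
  show "\<forall>i. \<exists>\<mu>\<in>L. \<mu> @ [i] \<notin> L"
  proof (rule ccontr)
    assume "\<not> (\<forall>i. \<exists>\<mu>\<in>L. \<mu> @ [i] \<notin> L)"
    then obtain i where i: "\<And>\<mu>. \<mu> \<in> L \<Longrightarrow> \<mu> @ [i] \<in> L"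
      by auto
    have i_in_L: "[i] \<in> L"
      using i[OF Nil_in_L] by simp
    let ?S = "diagonal_ops \<inter> {a. entry a [] = entry a [i]}"
    note D = cstar_subalgebra_diagonal_ops[unfolded cstar_subalgebra_def]
    have "cstar_subalgebra ?S"
      unfolding cstar_subalgebra_def
    proof (intro conjI)
      show "csubspace ?S"
        using D by (auto simp: complex_vector.subspace_def entry_simps)
      show "closed ?S"
        using D closed_entry_eq by (intro closed_Int) auto
    qed (use D Nil_in_L i_in_L in \<open>auto simp: diagonal_ops_bounded entry_compose entry_adj\<close>)
    moreover have "source_proj L e \<mu> \<in> ?S" if "\<mu> \<in> L" for \<mu>
      using that i[OF that] i_in_L Nil_in_L by (simp add: source_proj_diagonal entry_source_proj)
    ultimately have "P \<in> ?S"
      using coeff_algebra_subset[of ?S] P by blast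
    then show False
      using entry_vacuum_proj[OF Nil_in_L] entry_vacuum_proj[OF i_in_L] by simp
  qed
next
  assume "\<forall>i. \<exists>\<mu>\<in>L. \<mu> @ [i] \<notin> L"
  then obtain \<mu> where "\<And>i. \<mu> i \<in> L" "\<And>i. \<mu> i @ [i] \<notin> L"
    by metis
  then show "P \<in> A"
    using source_proj_prod_in_coeff_algebra[of \<mu>] source_proj_prod_eq_vacuum_proj[of \<mu>] by simp
qed


section \<open>The left action\<close>

lemma correspondence_generator: "a \<in> A \<Longrightarrow> T i o\<^sub>L a \<in> E"
  unfolding correspondence_def
  by (intro subsetD[OF closure_subset] complex_vector.span_base) auto

lemma creation_in_correspondence: "T i \<in> E"
  using correspondence_generator[OF id_in_coeff_algebra] by (simp add: blinfun_compose_id)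

lemma correspondence_subset:
  assumes "\<And>i a. a \<in> A \<Longrightarrow> T i o\<^sub>L a \<in> S" "csubspace S" "closed S"
  shows "E \<subseteq> S"
  unfolding correspondence_def using assms by (intro closure_cspan_subset) auto

lemma correspondence_bounded: "\<xi> \<in> E \<Longrightarrow> \<xi> \<in> bounded_ops"
  using correspondence_subset[OF _ csubspace_bounded_ops closed_bounded_ops]
  by (auto intro: bounded_ops_compose creation_in_bounded_ops coeff_in_bounded_ops)

lemma continuous_on_compose_left: "continuous_on S (\<lambda>\<xi>. a o\<^sub>L \<xi>)"
  by (intro bounded_bilinear.continuous_on[OF bounded_bilinear_blinfun_compose] continuous_intros)

text \<open>Operators supported on the vacuum kill \<open>E\<close>, since every \<open>T\<^sub>i\<close> maps into its complement.\<close>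

lemma compose_correspondence_eq_0:
  assumes a: "a \<in> diagonal_ops" "\<And>\<nu>. \<nu> \<in> L \<Longrightarrow> \<nu> \<noteq> [] \<Longrightarrow> entry a \<nu> = 0" and "\<xi> \<in> E"
  shows "a o\<^sub>L \<xi> = 0"
proof -
  have "a o\<^sub>L T i = 0" for i
    using a complex_vector.subspace_0[OF csubspace_bounded_ops]
    by (intro bounded_ops_eqI)
      (auto simp: bounded_ops_compose creation_in_bounded_ops diagonal_ops_bounded creation_apply
        diagonal_apply)
  then have "a o\<^sub>L (T i o\<^sub>L b) = 0" for i b
    by (simp flip: blinfun_compose_assoc)
  moreover have "csubspace {\<xi> :: 'h op. a o\<^sub>L \<xi> = 0}"
    using a(1) by (auto simp: complex_vector.subspace_def compose_scaleC_blinfun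
        diagonal_ops_bounded blinfun_compose_add_right)
  moreover have "closed {\<xi> :: 'h op. a o\<^sub>L \<xi> = 0}"
    by (intro closed_Collect_eq continuous_on_compose_left continuous_on_const)
  ultimately have "E \<subseteq> {\<xi> :: 'h op. a o\<^sub>L \<xi> = 0}"
    by (intro correspondence_subset) auto
  then show ?thesis
    using \<open>\<xi> \<in> E\<close> by auto
qed

text \<open>
  Because \<open>A\<close> is unital, \<open>T\<^sub>i\<close> itself lies in \<open>E\<close>, and \<open>a T\<^sub>i e\<^sub>\<nu> = a e\<^bsub>i\<nu>\<^esub>\<close> reads off the entry of \<open>a\<close>
  at \<open>i\<nu>\<close>.
\<close>

lemma ker_left_action_entries:
  "ker_left_action A E = {a \<in> A. \<forall>\<nu>\<in>L. \<nu> \<noteq> [] \<longrightarrow> entry a \<nu> = 0}"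
proof (intro set_eqI iffI)
  fix a
  assume "a \<in> ker_left_action A E"
  then have a: "a \<in> A" and eq: "left_action E a = (\<lambda>\<xi>\<in>E. 0)"
    by (auto simp: ker_left_action_def)
  have kill: "a o\<^sub>L T i = 0" for i
    using fun_cong[OF eq, of "T i"] creation_in_correspondence[of i]
    by (simp add: left_action_def)
  have "entry a (i # \<nu>) = 0" if "i # \<nu> \<in> L" for i \<nu>
  proof -
    have "a (e (i # \<nu>)) = (a o\<^sub>L T i) (e \<nu>)"
      using that Cons_in_L[OF that] by (simp add: creation_apply)
    then show ?thesis
      by (simp add: kill entry_def)
  qed
  then have "entry a \<nu> = 0" if "\<nu> \<in> L" "\<nu> \<noteq> []" for \<nu>
    using that by (cases \<nu>) auto
  then show "a \<in> {a \<in> A. \<forall>\<nu>\<in>L. \<nu> \<noteq> [] \<longrightarrow> entry a \<nu> = 0}"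
    using a by simp
next
  fix a
  assume "a \<in> {a \<in> A. \<forall>\<nu>\<in>L. \<nu> \<noteq> [] \<longrightarrow> entry a \<nu> = 0}"
  then show "a \<in> ker_left_action A E"
    by (auto simp: ker_left_action_def left_action_def compose_correspondence_eq_0
        coeff_in_diagonal_ops intro!: restrict_ext)
qed

lemma ker_left_action_scaleC:
  assumes "a \<in> ker_left_action A E"
  shows "a = entry a [] *\<^sub>C P"
proof (rule diagonal_eqI)
  show "entry a [] *\<^sub>C P \<in> diagonal_ops"
    using cstar_subalgebra_diagonal_ops vacuum_proj_diagonal
    by (auto simp: cstar_subalgebra_def intro: complex_vector.subspace_scale)
qed (use assms in \<open>auto simp: ker_left_action_entries coeff_in_diagonal_ops entry_simps
      entry_vacuum_proj\<close>)

lemma ker_left_action_eq_span: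
  assumes "P \<in> A"
  shows "ker_left_action A E = {c *\<^sub>C P |c. True}"
proof (intro subset_antisym subsetI)
  show "a \<in> {c *\<^sub>C P |c. True}" if "a \<in> ker_left_action A E" for a
    using ker_left_action_scaleC[OF that] by blast
  show "a \<in> ker_left_action A E" if "a \<in> {c *\<^sub>C P |c. True}" for a
    using that assms complex_vector.subspace_scale[OF csubspace_coeff_algebra]
    by (auto simp: ker_left_action_entries entry_simps entry_vacuum_proj)
qed

lemma ker_left_action_eq_0:
  assumes "P \<notin> A"
  shows "ker_left_action A E = {0}"
proof -
  have "a = 0" if a: "a \<in> ker_left_action A E" for a
  proof (rule ccontr)
    assume "a \<noteq> 0"
    then have "entry a [] \<noteq> 0"
      using ker_left_action_scaleC[OF a] by auto
    then have "P = (1 / entry a []) *\<^sub>C a"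
      using ker_left_action_scaleC[OF a]
      by (metis nonzero_divide_eq_eq scaleC_one scaleC_scaleC)
    moreover have "a \<in> A"
      using a by (simp add: ker_left_action_def)
    ultimately show False
      using assms complex_vector.subspace_scale[OF csubspace_coeff_algebra] by metis
  qed
  moreover have "0 \<in> ker_left_action A E"
    using complex_vector.subspace_0[OF csubspace_coeff_algebra]
    by (simp add: ker_left_action_entries entry_simps)
  ultimately show ?thesis
    by auto
qed

lemma gen_ideal_eqI:
  assumes "closed_ideal A K" "b \<in> K" "\<And>k. k \<in> K \<Longrightarrow> \<exists>a\<in>A. k = a o\<^sub>L b"
  shows "gen_ideal A b = K"
  unfolding gen_ideal_def
proof (rule hull_unique)
  fix K'
  assume "{b} \<subseteq> K'" "closed_ideal A K'"
  then have "a o\<^sub>L b \<in> K'" if "a \<in> A" for a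
    using that by (simp add: closed_ideal_def)
  then show "K \<subseteq> K'"
    using assms(3) by blast
qed (use assms in simp_all)

lemma gen_ideal_vacuum_proj:
  assumes P: "P \<in> A"
  shows "gen_ideal A P = ker_left_action A E"
proof (rule gen_ideal_eqI)
  have "ker_left_action A E = A \<inter> (\<Inter>\<nu>\<in>L - {[]}. {a. entry a \<nu> = entry 0 \<nu>})"
    by (auto simp: ker_left_action_entries entry_simps)
  then have "closed (ker_left_action A E)"
    by (auto simp: entry_def
      intro!: closed_Int closed_coeff_algebra closed_INT closed_Collect_eq cinner.continuous_on
        continuous_intros)
  then show "closed_ideal A (ker_left_action A E)"
    using csubspace_coeff_algebra
    by (auto simp: closed_ideal_def ker_left_action_entries complex_vector.subspace_def entry_simps
        entry_compose coeff_in_diagonal_ops compose_in_coeff_algebra)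
  show "P \<in> ker_left_action A E"
    using P by (simp add: ker_left_action_entries entry_vacuum_proj)
  show "\<exists>a\<in>A. k = a o\<^sub>L P" if k: "k \<in> ker_left_action A E" for k
  proof
    show "k \<in> A"
      using k by (simp add: ker_left_action_def)
    then show "k = k o\<^sub>L P"
      using k by (intro diagonal_eqI)
        (auto simp: coeff_in_diagonal_ops diagonal_compose vacuum_proj_diagonal entry_compose
          entry_vacuum_proj ker_left_action_entries)
  qed
qed


section \<open>Katsura's ideal\<close>

text \<open>A diagonal \<open>a\<close> moves past \<open>T\<^sub>i\<close> as its compression, which is again a coefficient.\<close>

lemma left_mult_correspondence:
  assumes a: "a \<in> A" and "\<xi> \<in> E"
  shows "a o\<^sub>L \<xi> \<in> E"
proof -
  define X where "X = {T i o\<^sub>L b |i b. b \<in> A}"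
  have E: "E = closure (cspan X)"
    by (simp add: correspondence_def X_def)
  have intertwine: "a o\<^sub>L T i = T i o\<^sub>L (adj (T i) o\<^sub>L a o\<^sub>L T i)" for i
    using a
    by (intro bounded_ops_eqI)
      (auto simp: bounded_ops_compose adj_in_bounded_ops creation_in_bounded_ops
        coeff_in_bounded_ops creation_apply diagonal_apply[OF coeff_in_diagonal_ops]
        adj_creation_apply bounded_opsD dest: Cons_in_L)
  have "a o\<^sub>L \<eta> \<in> cspan X" if "\<eta> \<in> cspan X" for \<eta>
  proof -
    have "X \<subseteq> {\<eta>. a o\<^sub>L \<eta> \<in> cspan X}"
    proof safe
      fix \<eta>
      assume "\<eta> \<in> X"
      then obtain i b where "b \<in> A" and \<eta>: "\<eta> = T i o\<^sub>L b"
        by (auto simp: X_def)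
      have "a o\<^sub>L \<eta> = T i o\<^sub>L ((adj (T i) o\<^sub>L a o\<^sub>L T i) o\<^sub>L b)"
        by (simp only: \<eta> intertwine blinfun_compose_assoc[symmetric])
      moreover have "(adj (T i) o\<^sub>L a o\<^sub>L T i) o\<^sub>L b \<in> A"
        using a \<open>b \<in> A\<close> by (intro compose_in_coeff_algebra compression_in_coeff_algebra)
      ultimately show "a o\<^sub>L \<eta> \<in> cspan X"
        by (intro complex_vector.span_base) (auto simp: X_def)
    qed
    moreover have "csubspace {\<eta>. a o\<^sub>L \<eta> \<in> cspan X}"
      using a by (auto simp: complex_vector.subspace_def compose_scaleC_blinfun
          coeff_in_bounded_ops blinfun_compose_add_right
          intro: complex_vector.span_zero complex_vector.span_add complex_vector.span_scale)
    ultimately show ?thesis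
      using complex_vector.span_minimal that by blast
  qed
  then have "(\<lambda>\<xi>. a o\<^sub>L \<xi>) ` E \<subseteq> E"
    unfolding E by (intro image_closure_subset continuous_on_compose_left closed_closure)
      (auto intro: subsetD[OF closure_subset])
  then show ?thesis
    using \<open>\<xi> \<in> E\<close> by blast
qed

text \<open>
  \<open>\<Sum>\<^sub>i T\<^sub>i T\<^sub>i\<^sup>* = 1 - P\<close> acts as the identity on \<open>E\<close>, so the left action of \<open>a\<close> is the finite sum of
  the rank one maps \<open>\<zeta> \<mapsto> (a T\<^sub>i)\<langle>T\<^sub>i, \<zeta>\<rangle>\<close>.
\<close>

lemma left_action_finite_rank:
  assumes a: "a \<in> A"
  shows "left_action E a \<in> finite_rank_ops E"
proof -
  obtain h where h: "bij_betw h {..<CARD('d)} (UNIV :: 'd set)"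
    using ex_bij_betw_nat_finite[of "UNIV :: 'd set"] by (auto simp: lessThan_atLeast0)
  have "a o\<^sub>L \<zeta> = (\<Sum>k<CARD('d). 1 *\<^sub>C ((a o\<^sub>L T (h k)) o\<^sub>L module_inner (T (h k)) \<zeta>))"
    if "\<zeta> \<in> E" for \<zeta>
  proof -
    have "(\<Sum>k<CARD('d). 1 *\<^sub>C ((a o\<^sub>L T (h k)) o\<^sub>L module_inner (T (h k)) \<zeta>)) =
        (\<Sum>i\<in>UNIV. (a o\<^sub>L T i) o\<^sub>L (adj (T i) o\<^sub>L \<zeta>))"
      using sum.reindex_bij_betw[OF h, of "\<lambda>i. (a o\<^sub>L T i) o\<^sub>L (adj (T i) o\<^sub>L \<zeta>)"]
      by (simp add: module_inner_def scaleC_one)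
    also have "\<dots> = a o\<^sub>L ((\<Sum>i\<in>UNIV. T i o\<^sub>L adj (T i)) o\<^sub>L \<zeta>)"
      by (rule blinfun_eqI) (simp add: blinfun.sum_left blinfun.sum_right)
    also have "(\<Sum>i\<in>UNIV. T i o\<^sub>L adj (T i)) o\<^sub>L \<zeta> = \<zeta> - (P o\<^sub>L \<zeta>)"
      unfolding sum_range_projections by (rule blinfun_eqI) (simp add: blinfun.diff_left)
    also have "P o\<^sub>L \<zeta> = 0"
      using that by (intro compose_correspondence_eq_0)
        (auto simp: vacuum_proj_diagonal entry_vacuum_proj)
    finally show ?thesis
      by simp
  qed
  then have "left_action E a =
      (\<lambda>\<zeta>\<in>E. \<Sum>k<CARD('d). 1 *\<^sub>C ((a o\<^sub>L T (h k)) o\<^sub>L module_inner (T (h k)) \<zeta>))"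
    unfolding left_action_def by (intro restrict_ext)
  moreover have "\<forall>k<CARD('d). a o\<^sub>L T (h k) \<in> E \<and> T (h k) \<in> E"
    using a by (simp add: left_mult_correspondence creation_in_correspondence)
  ultimately show ?thesis
    unfolding finite_rank_ops_def
    by (intro CollectI exI[of _ "CARD('d)"] exI[of _ "\<lambda>_. 1"] exI[of _ "\<lambda>k. a o\<^sub>L T (h k)"]
        exI[of _ "\<lambda>k. T (h k)"] conjI)
qed

lemma left_action_compact:
  assumes a: "a \<in> A"
  shows "left_action E a \<in> compact_ops E"
proof -
  have maps: "left_action E b \<in> E \<rightarrow>\<^sub>E E" if "b \<in> A" for b
    using that by (auto simp: left_action_def left_mult_correspondence)
  have "module_inner (left_action E a \<xi>) \<eta> = module_inner \<xi> (left_action E (adj a) \<eta>)"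
    if "\<xi> \<in> E" "\<eta> \<in> E" for \<xi> \<eta>
    using that a by (simp add: left_action_def module_inner_def adj_compose coeff_in_bounded_ops
        correspondence_bounded blinfun_compose_assoc)
  then have "left_action E a \<in> adjointable_ops E"
    using maps[OF a] maps[OF adj_in_coeff_algebra[OF a]] by (auto simp: adjointable_ops_def)
  moreover have "module_norm (0 :: 'h op) = 0"
    by (simp add: module_norm_def module_inner_def)
  ultimately show ?thesis
    using left_action_finite_rank[OF a]
    by (auto simp: compact_ops_def module_norm_def intro!: bexI[of _ "left_action E a"])
qed

text \<open>The compactness condition in Katsura's ideal is automatic.\<close>

lemma katsura_ideal_eq: "katsura_ideal A E = annihilator A (ker_left_action A E)"
  by (auto simp: katsura_ideal_def annihilator_def left_action_compact)

lemma katsura_ideal_entries: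
  assumes P: "P \<in> A"
  shows "katsura_ideal A E = {a \<in> A. entry a [] = 0}"
proof (intro set_eqI iffI)
  fix a
  assume "a \<in> katsura_ideal A E"
  then have a: "a \<in> A" "a o\<^sub>L P = 0"
    using P by (auto simp: katsura_ideal_eq annihilator_def ker_left_action_entries
        entry_vacuum_proj)
  have "entry a [] = entry (a o\<^sub>L P) []"
    using a(1) Nil_in_L
    by (simp add: entry_compose coeff_in_diagonal_ops vacuum_proj_diagonal entry_vacuum_proj)
  then show "a \<in> {a \<in> A. entry a [] = 0}"
    using a by (simp add: entry_simps)
next
  fix a
  assume a: "a \<in> {a \<in> A. entry a [] = 0}"
  have "a o\<^sub>L k = 0" if "k \<in> ker_left_action A E" for k
    using that a complex_vector.subspace_0[OF csubspace_coeff_algebra]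
    by (intro diagonal_eqI)
      (auto simp: ker_left_action_entries coeff_in_diagonal_ops diagonal_compose entry_compose
        entry_simps)
  then show "a \<in> katsura_ideal A E"
    using a by (simp add: katsura_ideal_eq annihilator_def)
qed

lemma katsura_ideal_vacuum_complement:
  assumes P: "P \<in> A"
  shows "katsura_ideal A E = {a o\<^sub>L (id_blinfun - P) |a. a \<in> A}"
    and "gen_ideal A (id_blinfun - P) = katsura_ideal A E"
proof -
  have Q: "id_blinfun - P \<in> A"
    using complex_vector.subspace_diff[OF csubspace_coeff_algebra id_in_coeff_algebra P] .
  have fix_Q: "a = a o\<^sub>L (id_blinfun - P)" if "a \<in> katsura_ideal A E" for a
    using that Q by (intro diagonal_eqI)
      (auto simp: katsura_ideal_entries[OF P] coeff_in_diagonal_ops diagonal_compose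
        entry_compose entry_simps entry_id entry_vacuum_proj)
  have ideal: "a o\<^sub>L b \<in> katsura_ideal A E" "b o\<^sub>L a \<in> katsura_ideal A E"
    if "a \<in> A" "b \<in> katsura_ideal A E" for a b
    using that Nil_in_L by (auto simp: katsura_ideal_entries[OF P] compose_in_coeff_algebra
        entry_compose coeff_in_diagonal_ops)
  have Q_in: "id_blinfun - P \<in> katsura_ideal A E"
    using Q Nil_in_L by (simp add: katsura_ideal_entries[OF P] entry_simps entry_id
        entry_vacuum_proj)
  show "katsura_ideal A E = {a o\<^sub>L (id_blinfun - P) |a. a \<in> A}"
    using fix_Q ideal(1)[OF _ Q_in] by (auto simp: katsura_ideal_eq annihilator_def)
  show "gen_ideal A (id_blinfun - P) = katsura_ideal A E"
  proof (rule gen_ideal_eqI)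
    have "katsura_ideal A E = A \<inter> {a :: 'h op. cinner (e []) (a (e [])) = 0}"
      by (auto simp: katsura_ideal_entries[OF P] entry_def)
    then have "closed (katsura_ideal A E)"
      by (auto intro!: closed_Int closed_coeff_algebra closed_Collect_eq cinner.continuous_on
          continuous_intros)
    moreover have "csubspace (katsura_ideal A E)"
      using csubspace_coeff_algebra
      by (auto simp: katsura_ideal_entries[OF P] complex_vector.subspace_def entry_simps)
    ultimately show "closed_ideal A (katsura_ideal A E)"
      using ideal by (auto simp: closed_ideal_def katsura_ideal_eq annihilator_def)
    show "\<exists>a\<in>A. k = a o\<^sub>L (id_blinfun - P)" if "k \<in> katsura_ideal A E" for k
      using fix_Q[OF that] that by (auto simp: katsura_ideal_def annihilator_def)
  qed (rule Q_in)
qed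

lemma id_in_katsura_ideal_iff: "id_blinfun \<in> katsura_ideal A E \<longleftrightarrow> P \<notin> A"
proof (cases "P \<in> A")
  case True
  then show ?thesis
    using Nil_in_L by (simp add: katsura_ideal_entries entry_id)
next
  case False
  then show ?thesis
    by (simp add: katsura_ideal_eq annihilator_def ker_left_action_eq_0 id_in_coeff_algebra)
qed

end


section \<open>Words of a monomial ideal\<close>

lemma ncmonom_append: "ncmonom (\<mu> @ \<nu>) = ncmonom \<mu> * ncmonom \<nu>"
  by (simp add: ncmonom_def)

lemma ncmonom_singleton: "ncmonom [i] = ncvar i"
  by (simp add: ncmonom_def)

lemma ncmonom_eq_single: "ncmonom \<mu> = Poly_Mapping.single (\<mu> :: 'a list) 1"
proof (induction \<mu>)
  case Nil
  have "ncmonom [] = (Poly_Mapping.single 0 1 :: 'a ncpoly)"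
    by (simp add: ncmonom_def)
  then show ?case
    by (simp only: zero_list_def)
next
  case (Cons i \<mu>)
  then show ?case
    by (simp add: ncmonom_def ncvar_def mult_single plus_list_def)
qed

lemma two_sided_ideal_monomial_ideal: "monomial_ideal I \<Longrightarrow> two_sided_ideal I"
  unfolding monomial_ideal_def
  by (elim exE conjE, simp only:, rule hull_in) (auto simp: two_sided_ideal_def)

text \<open>
  This proper ideal contains every monomial ideal, which therefore does not contain \<open>1 = x\<^sup>\<emptyset>\<close>.
\<close>

lemma two_sided_ideal_no_constant_term:
  "two_sided_ideal {p :: 'd ncpoly. Poly_Mapping.lookup p [] = 0}"
proof -
  have "Poly_Mapping.lookup (p * q) [] = 0"
    if "Poly_Mapping.lookup p [] = 0 \<or> Poly_Mapping.lookup q [] = 0" for p q :: "'d ncpoly"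
  proof -
    have "[] \<notin> {a + b |a b. a \<in> Poly_Mapping.keys p \<and> b \<in> Poly_Mapping.keys q}"
      using that by (auto simp: plus_list_def in_keys_iff)
    then show ?thesis
      using subsetD[OF keys_mult[of p q], of "[]"] unfolding in_keys_iff by blast
  qed
  then show ?thesis
    by (auto simp: two_sided_ideal_def lookup_add)
qed

lemma Nil_in_allowed_words:
  fixes I :: "'a ncpoly set"
  assumes "monomial_ideal I"
  shows "[] \<in> allowed_words I"
proof -
  obtain M where M: "\<forall>\<mu>\<in>M. 2 \<le> length \<mu>" and I: "I = two_sided_ideal hull (ncmonom ` M)"
    using assms by (auto simp: monomial_ideal_def)
  have "I \<subseteq> {p. Poly_Mapping.lookup p [] = 0}"
    unfolding I
  proof (rule hull_minimal)
    show "ncmonom ` M \<subseteq> {p. Poly_Mapping.lookup p [] = 0}"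
    proof safe
      fix \<mu>
      assume "\<mu> \<in> M"
      then have "\<mu> \<noteq> []"
        using M by auto
      then show "Poly_Mapping.lookup (ncmonom \<mu>) [] = 0"
        by (simp add: ncmonom_eq_single lookup_single)
    qed
  qed (rule two_sided_ideal_no_constant_term)
  moreover have "ncmonom [] \<notin> {p :: 'a ncpoly. Poly_Mapping.lookup p [] = 0}"
    by (simp add: ncmonom_eq_single)
  ultimately show ?thesis
    unfolding allowed_words_def by blast
qed

lemma allowed_words_appendD:
  assumes "monomial_ideal I" "\<mu> @ \<nu> \<in> allowed_words I"
  shows "\<mu> \<in> allowed_words I" "\<nu> \<in> allowed_words I"
proof -
  have ideal: "ncmonom \<mu> \<in> I \<Longrightarrow> ncmonom \<mu> * ncmonom \<nu> \<in> I"
    "ncmonom \<nu> \<in> I \<Longrightarrow> ncmonom \<mu> * ncmonom \<nu> \<in> I"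
    using two_sided_ideal_monomial_ideal[OF assms(1)] by (simp_all add: two_sided_ideal_def)
  show "\<mu> \<in> allowed_words I" "\<nu> \<in> allowed_words I"
    using assms(2) ideal by (auto simp: allowed_words_def ncmonom_append)
qed

theorem proposition5p8:
  fixes I :: "'d::{finite,linorder} ncpoly set"
    and e :: "'d list \<Rightarrow> 'h::complex_hilbert"
  defines "L \<equiv> allowed_words I"
  defines "A \<equiv> coeff_algebra L e"
    and "E \<equiv> correspondence L e"
    and "P \<equiv> rank_one_proj (e [])"
    and "one \<equiv> (id_blinfun :: 'h op)"
  assumes "monomial_ideal I"
    and "orthonormal_basis_on L e"
  shows
    "(P \<in> A \<longleftrightarrow> P \<in> A \<and> ker_left_action A E = gen_ideal A P) \<and>
     (P \<in> A \<longleftrightarrow> ker_left_action A E = {c *\<^sub>C P |c. True}) \<and>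
     (P \<in> A \<longleftrightarrow> ker_left_action A E \<noteq> {0}) \<and>
     (P \<in> A \<longleftrightarrow> (\<forall>i. \<exists>\<mu>\<in>L. \<mu> @ [i] \<notin> L)) \<and>
     (P \<in> A \<longleftrightarrow> (\<forall>i. \<exists>\<mu>. ncmonom \<mu> \<notin> I \<and> ncmonom \<mu> * ncvar i \<in> I)) \<and>
     (P \<in> A \<longleftrightarrow>
        one - P \<in> A \<and> katsura_ideal A E = gen_ideal A (one - P) \<and>
        gen_ideal A (one - P) = {a o\<^sub>L (one - P) |a. a \<in> A}) \<and>
     (P \<in> A \<longleftrightarrow> one \<notin> katsura_ideal A E) \<and>
     (P \<in> A \<longrightarrow>
        (\<forall>\<mu>. (\<forall>i. \<mu> i \<in> L \<and> \<mu> i @ [i] \<notin> L) \<longrightarrow>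
          source_proj_prod L e \<mu> \<in> A \<and>
          ker_left_action A E = gen_ideal A (source_proj_prod L e \<mu>)))"
proof -
  interpret fock_space L e
  proof
    show "orthonormal_basis_on L e"
      by fact
    show "[] \<in> L"
      unfolding L_def by (rule Nil_in_allowed_words) fact
    show "\<mu> \<in> L" "\<nu> \<in> L" if "\<mu> @ \<nu> \<in> L" for \<mu> \<nu>
      using that unfolding L_def by (fact allowed_words_appendD[OF \<open>monomial_ideal I\<close>])+
  qed
  note P_in_A_iff = vacuum_proj_in_coeff_algebra_iff[folded A_def P_def]
    and ker_span = ker_left_action_eq_span[folded A_def E_def P_def]
    and ker_0 = ker_left_action_eq_0[folded A_def E_def P_def]
    and gen_P = gen_ideal_vacuum_proj[folded A_def E_def P_def]
    and katsura = katsura_ideal_vacuum_complement[folded A_def E_def P_def one_def]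
    and one_in_katsura = id_in_katsura_ideal_iff[folded A_def E_def P_def one_def]
    and prod_P = source_proj_prod_eq_vacuum_proj[folded P_def]
    and P_nonzero = vacuum_proj_nonzero[folded P_def]
    and A_diff = complex_vector.subspace_diff[OF csubspace_coeff_algebra, folded A_def]
    and one_in_A = id_in_coeff_algebra[folded A_def one_def]
  have P_span: "P \<in> {c *\<^sub>C P |c. True}"
    by (auto intro: exI[of _ 1] simp: scaleC_one)
  have ker_subset: "ker_left_action A E \<subseteq> A"
    by (auto simp: ker_left_action_def)
  have "(\<exists>\<mu>\<in>L. \<mu> @ [i] \<notin> L) \<longleftrightarrow> (\<exists>\<mu>. ncmonom \<mu> \<notin> I \<and> ncmonom \<mu> * ncvar i \<in> I)" for i
    by (auto simp: L_def allowed_words_def ncmonom_append ncmonom_singleton)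
  then have vi: "P \<in> A \<longleftrightarrow> (\<forall>i. \<exists>\<mu>. ncmonom \<mu> \<notin> I \<and> ncmonom \<mu> * ncvar i \<in> I)"
    using P_in_A_iff by simp
  have ii: "P \<in> A \<longleftrightarrow> P \<in> A \<and> ker_left_action A E = gen_ideal A P"
    using gen_P by auto
  have iii: "P \<in> A \<longleftrightarrow> ker_left_action A E = {c *\<^sub>C P |c. True}"
  proof
    assume eq: "ker_left_action A E = {c *\<^sub>C P |c. True}"
    show "P \<in> A"
      using P_span ker_subset unfolding eq[symmetric] by (rule subsetD[rotated])
  qed (rule ker_span)
  have iv: "P \<in> A \<longleftrightarrow> ker_left_action A E \<noteq> {0}"
  proof
    assume "P \<in> A"
    then have "P \<in> ker_left_action A E"
      using P_span ker_span by simp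
    then show "ker_left_action A E \<noteq> {0}"
      using P_nonzero by (metis singletonD)
  next
    show "P \<in> A" if "ker_left_action A E \<noteq> {0}"
      using that ker_0 by (rule contrapos_np)
  qed
  have "P \<in> A" if "one - P \<in> A"
    using A_diff[OF one_in_A that] by simp
  then have vii: "P \<in> A \<longleftrightarrow>
      one - P \<in> A \<and> katsura_ideal A E = gen_ideal A (one - P) \<and>
      gen_ideal A (one - P) = {a o\<^sub>L (one - P) |a. a \<in> A}"
    using katsura A_diff[OF one_in_A] by (metis (no_types, lifting))
  have viii: "P \<in> A \<longleftrightarrow> one \<notin> katsura_ideal A E"
    using one_in_katsura by simp
  have "source_proj_prod L e \<mu> \<in> A \<and>
      ker_left_action A E = gen_ideal A (source_proj_prod L e \<mu>)"
    if "P \<in> A" "\<forall>i. \<mu> i \<in> L \<and> \<mu> i @ [i] \<notin> L" for \<mu>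
  proof -
    have "source_proj_prod L e \<mu> = P"
      using that(2) by (intro prod_P) blast+
    then show ?thesis
      using that(1) gen_P by simp
  qed
  then have last: "P \<in> A \<longrightarrow> (\<forall>\<mu>. (\<forall>i. \<mu> i \<in> L \<and> \<mu> i @ [i] \<notin> L) \<longrightarrow>
      source_proj_prod L e \<mu> \<in> A \<and>
      ker_left_action A E = gen_ideal A (source_proj_prod L e \<mu>))"
    by (intro impI allI)
  show ?thesis
    by (intro conjI ii iii iv P_in_A_iff vi vii viii last)
qed

end
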